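(* Let $\zeta=e^{i\pi/6}$ and $\rho=2r\sqrt3$, where $6r=\frac{2^{-4/3}3^{1/2}}{\pi}\Gamma\!\left(\frac13\right)^3$. Then for every integer $n\ge 2$ the pseudo-factorial $\alpha_n$ is given by the lattice sum $$\alpha_n=-\frac{n!}{\rho^{n+1}}\sum_{\lambda,\mu\in\mathbb{Z}}\frac{\zeta^{8\lambda+4\mu}}{\left[\left(\lambda-\frac12\right)\zeta+\left(\mu-\frac12\right)\zeta^{-1}\right]^{n+1}}.$$
   Context: The pseudo-factorials $(\alpha_n)_{n\ge 0}$ are the integers defined by $\alpha_0=1$ and $\alpha_{n+1}=(-1)^{n+1}\sum_{k=0}^n\binom{n}{k}\alpha_k\alpha_{n-k}$ for $n\ge 0$. *)

theory Defs
  imports "HOL-Analysis.Analysis"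
begin

fun pseudo_factorial :: "nat \<Rightarrow> int" where
  "pseudo_factorial 0 = 1"
| "pseudo_factorial (Suc n) =
     (-1) ^ (n + 1) *
       (\<Sum>k\<in>{0..n}. int (n choose k) * pseudo_factorial k * pseudo_factorial (n - k))"

end

theory Submission
  imports Defs "HOL-Complex_Analysis.Complex_Analysis"
begin

text \<open>
The recurrence says that the exponential generating function g of the pseudo-factorials satisfies
g'(z) = - g(-z)^2 and g(0) = 1. Then g(z)^3 + g(-z)^3 = 2 is a first integral, so g inverts an
integral of (2 - y^3)^(-2/3) and is an elliptic function: its poles are simple, they form a
shifted hexagonal lattice, and the residues are cube roots of unity that depend on the lattice
point through a character \<chi>. The claim is the partial fraction expansion of g, compared
coefficient by coefficient: a summand c / (z - p) contributes - n! c / p^(n+1) to the n-th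
derivative at 0.

The proof constructs the function from its poles and then recognises it by its differential
equation. The series \<Sum> \<chi>(i) / (z - p(i)) does not converge absolutely, but a shift of the
summation index only multiplies it by a cube root of unity. Averaging over the six shortest
lattice vectors therefore changes it by a constant factor, and replaces 1 / w by the kernel
1 / (w (w^6 + 1)), which decays fast. The resulting function \<open>twisted_zeta\<close> converges absolutely, and
its symmetries are read off from the series by reindexing: translation by a lattice vector
multiplies it by \<chi> (\<open>twisted_zeta_translate\<close>), rotation by 2 \<pi> / 3 about a pole multiplies it by
a cube root of unity (\<open>twisted_zeta_rotate\<close>), and it commutes with complex conjugation.

The rotation leaves only the form 1 / u + u m(u) for the expansion at a pole, with m holomorphic, so
the singularities of Z'(z) + Z(-z)^2 cancel, where Z is \<open>twisted_zeta\<close>. What remains is entire,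
bounded, and multiplied by a number other than 1 under some translation, hence zero by Liouville
(\<open>ode_defect_eq_0\<close>). Thus Z solves the differential equation of g with another initial value, and by
homogeneity its n-th derivative at 0 is Z(0)^(n+1) times the n-th pseudo-factorial
(\<open>higher_deriv_twisted_zeta_pseudo_factorial\<close>). Differentiating the series termwise gives the
lattice sum instead (\<open>higher_deriv_twisted_zeta\<close>).

It remains to identify Z(0) with \<rho>. On the real axis Z is real, and the rotation produces a zero at
sqrt 3 / 6. On the interval between this point and its negative, t = Z^3 / (2 Z(0)^3) decreases
from 1 to 0, and the differential equation turns t^(-2/3) (1 - t)^(-2/3) dt into a constant
multiple of dx. This evaluates Beta(1/3, 1/3) as sqrt 3 * 2^(1/3) * Z(0) (\<open>Beta_third\<close>), and the
reflection formula expresses the Beta value by Gamma(1/3)^3.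
\<close>

section \<open>The hexagonal lattice and its cubic character\<close>

text \<open>
The primitive twelfth root of unity e^(i \<pi> / 6) in Cartesian form, so that identities between
\<xi>, its conjugate and \<omega> can be decided by comparing real and imaginary parts.
\<close>
definition \<xi> :: complex where "\<xi> = Complex (sqrt 3 / 2) (1 / 2)"

definition \<omega> :: complex where "\<omega> = Complex (- 1 / 2) (sqrt 3 / 2)"

definition lattice_point :: "int \<times> int \<Rightarrow> complex" where
  "lattice_point i = of_int (fst i) * \<xi> + of_int (snd i) * cnj \<xi>"

definition pole :: "int \<times> int \<Rightarrow> complex" where
  "pole i = lattice_point i - of_real (sqrt 3 / 2)"

definition chi :: "int \<times> int \<Rightarrow> complex" where
  "chi i = \<omega> powi (2 * fst i + snd i)"

lemma xi_squared: "\<xi>\<^sup>2 = Complex (1/2) (sqrt 3 / 2)"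
  by (simp add: \<xi>_def power2_eq_square complex_eq_iff)

lemma xi_cubed: "\<xi> ^ 3 = \<i>"
proof -
  have "\<xi> ^ 3 = \<xi>\<^sup>2 * \<xi>" by (simp add: eval_nat_numeral)
  then show ?thesis unfolding xi_squared by (simp add: \<xi>_def complex_eq_iff)
qed

lemma xi_power4: "\<xi> ^ 4 = \<omega>"
proof -
  have "\<xi> ^ 4 = \<xi>\<^sup>2 * \<xi>\<^sup>2" by (simp add: eval_nat_numeral)
  then show ?thesis unfolding xi_squared by (simp add: \<omega>_def complex_eq_iff)
qed

lemma xi_power6: "\<xi> ^ 6 = -1"
proof -
  have "\<xi> ^ 6 = (\<xi>^3)^2" by simp
  then show ?thesis unfolding xi_cubed by simp
qed

lemma cnj_xi: "cnj \<xi> = inverse \<xi>" "cnj \<xi> = \<xi> - \<i>"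
proof -
  have "cnj \<xi> * \<xi> = 1" by (simp add: \<xi>_def complex_eq_iff power2_eq_square)
  then show "cnj \<xi> = inverse \<xi>" by (metis inverse_unique mult.commute)
  show "cnj \<xi> = \<xi> - \<i>" by (simp add: \<xi>_def complex_eq_iff)
qed

lemma omega_sum: "\<omega>\<^sup>2 = - 1 - \<omega>"
  by (simp add: \<omega>_def complex_eq_iff power2_eq_square)

lemma omega_cubed: "\<omega> ^ 3 = 1"
proof -
  have "\<omega> ^ 3 = \<omega>\<^sup>2 * \<omega>" by (simp add: eval_nat_numeral)
  also have "\<dots> = (- 1 - \<omega>) * \<omega>" by (simp only: omega_sum)
  also have "\<dots> = - \<omega> - \<omega>\<^sup>2" by (simp add: power2_eq_square algebra_simps)
  finally show ?thesis by (simp add: omega_sum)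
qed

lemma omega_nonzero: "\<omega> \<noteq> 0" and omega_neq_1: "\<omega> \<noteq> 1"
  by (auto simp: \<omega>_def complex_eq_iff)

lemma cnj_omega: "cnj \<omega> = \<omega>\<^sup>2"
  unfolding omega_sum by (simp add: \<omega>_def complex_eq_iff)

lemma inverse_omega: "inverse \<omega> = \<omega>\<^sup>2"
proof -
  have "\<omega> * \<omega>\<^sup>2 = 1" using omega_cubed by (simp add: eval_nat_numeral)
  then show ?thesis by (rule inverse_unique)
qed

lemma norm_omega: "norm \<omega> = 1"
  by (simp add: \<omega>_def cmod_def power2_eq_square)

lemma lattice_point_add: "lattice_point (i + j) = lattice_point i + lattice_point j"
  by (simp add: lattice_point_def algebra_simps)

lemma lattice_point_0: "lattice_point 0 = 0"
  by (simp add: lattice_point_def)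

lemma lattice_point_minus: "lattice_point (- i) = - lattice_point i"
  by (simp add: lattice_point_def)

lemma lattice_point_diff: "lattice_point (i - j) = lattice_point i - lattice_point j"
  by (simp add: lattice_point_def algebra_simps)

lemma pole_add: "pole (i + j) = pole i + lattice_point j"
  by (simp add: pole_def lattice_point_add)

lemma chi_add: "chi (i + j) = chi i * chi j"
  using omega_nonzero by (simp add: chi_def power_int_add[symmetric] algebra_simps)

lemma chi_nonzero: "chi i \<noteq> 0"
  using omega_nonzero by (simp add: chi_def)

lemma norm_chi: "norm (chi i) = 1"
  by (simp add: chi_def norm_power_int norm_omega)

lemma chi_minus: "chi (- i) = inverse (chi i)"
  by (simp add: chi_def power_int_minus[symmetric])

lemma chi_0: "chi 0 = 1"
  by (simp add: chi_def)

lemma norm_square_hexagonal: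
  "(norm (of_real a * \<xi> + of_real b * cnj \<xi>))\<^sup>2 = a\<^sup>2 + a * b + b\<^sup>2"
  unfolding cmod_power2 by (simp add: \<xi>_def power2_eq_square algebra_simps) 

lemma norm_square_lattice_point:
  "(norm (lattice_point (l, m)))\<^sup>2 = of_int (l\<^sup>2 + l * m + m\<^sup>2)"
  using norm_square_hexagonal[of "of_int l" "of_int m"] by (simp add: lattice_point_def)

lemma pole_eq: "pole (l, m) = (of_int l - 1 / 2) * \<xi> + (of_int m - 1 / 2) * cnj \<xi>"
  by (simp add: pole_def lattice_point_def \<xi>_def complex_eq_iff algebra_simps)

section \<open>Convergence of the lattice sum\<close>

text \<open>
The bound is a product, so that the lattice sum of |p|^(-3) is dominated by the square of a
one-dimensional series with exponent 3/2.
\<close>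
lemma norm_square_pole_ge:
  "(norm (pole (l, m)))\<^sup>2 \<ge> \<bar>of_int l - 1 / 2\<bar> * \<bar>of_int m - 1 / 2\<bar>"
proof -
  define a b where "a = real_of_int l - 1 / 2" and "b = real_of_int m - 1 / 2"
  have "(norm (pole (l, m)))\<^sup>2 = a\<^sup>2 + a * b + b\<^sup>2"
    using norm_square_hexagonal[of a b] by (simp add: pole_eq a_def b_def)
  moreover have "a\<^sup>2 + a * b + b\<^sup>2 \<ge> \<bar>a\<bar> * \<bar>b\<bar>"
  proof -
    have "(\<bar>a\<bar> - \<bar>b\<bar>)\<^sup>2 \<ge> 0" by simp
    then have "a\<^sup>2 + b\<^sup>2 \<ge> 2 * (\<bar>a\<bar> * \<bar>b\<bar>)" by (simp add: power2_diff)
    moreover have "a * b \<ge> - (\<bar>a\<bar> * \<bar>b\<bar>)"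
      by (metis abs_ge_minus_self abs_mult minus_le_iff)
    ultimately show ?thesis by linarith
  qed
  ultimately show ?thesis by (simp add: a_def b_def)
qed

lemma half_le_abs_half_integer: "\<bar>real_of_int l - 1 / 2\<bar> \<ge> 1 / 2"
proof (cases "l \<ge> 1")
  case True
  then have "real_of_int l \<ge> 1" by simp
  then show ?thesis by simp
next
  case False
  then have "real_of_int l \<le> 0" by simp
  then show ?thesis by simp
qed

lemma norm_pole_ge_half: "norm (pole i) \<ge> 1 / 2"
proof (cases i)
  case (Pair l m)
  have "(1/2)\<^sup>2 \<le> \<bar>real_of_int l - 1 / 2\<bar> * \<bar>real_of_int m - 1 / 2\<bar>"
    unfolding power2_eq_square
    by (rule mult_mono) (use half_le_abs_half_integer[of l] half_le_abs_half_integer[of m] in auto)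
  also have "\<dots> \<le> (norm (pole i))\<^sup>2" using norm_square_pole_ge Pair by simp
  finally show ?thesis by (rule power2_le_imp_le) simp
qed

lemma hexagonal_form_ge_1:
  assumes "(l, m) \<noteq> (0, 0)"
  shows "(l::int)\<^sup>2 + l * m + m\<^sup>2 \<ge> 1"
proof (rule ccontr)
  assume "\<not> ?thesis"
  moreover have "4 * (l\<^sup>2 + l * m + m\<^sup>2) = (2 * l + m)\<^sup>2 + 3 * m\<^sup>2"
    by (simp add: power2_eq_square algebra_simps)
  moreover have "(2 * l + m)\<^sup>2 \<ge> 0" "m\<^sup>2 \<ge> 0" by simp_all
  ultimately have "(2 * l + m)\<^sup>2 = 0 \<and> m\<^sup>2 = 0" by smt
  then show False using assms by simp
qed

lemma norm_lattice_point_ge_1: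
  assumes "i \<noteq> 0" shows "norm (lattice_point i) \<ge> 1"
proof (cases i)
  case (Pair l m)
  have "(norm (lattice_point i))\<^sup>2 \<ge> 1"
    unfolding Pair norm_square_lattice_point
    using hexagonal_form_ge_1[of l m] assms Pair
    by (metis of_int_1 of_int_le_iff zero_prod_def)
  then have "1\<^sup>2 \<le> (norm (lattice_point i))\<^sup>2" by simp
  then show ?thesis by (rule power2_le_imp_le) simp
qed

text \<open>
Split at 0, each half of the sum is, after its first term, dominated by the series of n^(-3/2).
\<close>
lemma summable_half_integer_powr:
  "(\<lambda>l. \<bar>real_of_int l - 1 / 2\<bar> powr (- 3 / 2)) summable_on UNIV"
proof -
  let ?f = "\<lambda>l::int. \<bar>real_of_int l - 1 / 2\<bar> powr (- 3 / 2)"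
  let ?h = "\<lambda>k::nat. (real k + 1 / 2) powr (- 3 / 2)"
  have s: "summable ?h"
  proof (subst summable_Suc_iff[symmetric], rule summable_comparison_test')
    have "summable (\<lambda>n. real n powr (- 3 / 2))"
      by (simp add: summable_real_powr_iff)
    then show "summable (\<lambda>n. real (Suc n) powr (- 3 / 2))"
      by (subst summable_Suc_iff)
    show "norm ((real (Suc n) + 1 / 2) powr (- 3 / 2)) \<le> real (Suc n) powr (- 3 / 2)" for n
      by (auto intro!: powr_mono2')
  qed
  then have h: "?h summable_on UNIV"
    by (subst summable_on_UNIV_nonneg_real_iff) auto
  have 1: "?f summable_on {1..}"
  proof (subst summable_on_reindex_bij_betw[symmetric])
    show "bij_betw (\<lambda>k. int k + 1) UNIV {1..}"
      by (rule bij_betwI[where g = "\<lambda>l. nat (l - 1)"]) auto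
    have "?f (int k + 1) = ?h k" for k
    proof -
      have "\<bar>real_of_int (int k + 1) - 1 / 2\<bar> = real k + 1 / 2" by simp
      then show ?thesis by (simp only:)
    qed
    then show "(\<lambda>k. ?f (int k + 1)) summable_on UNIV" using h by (simp only:)
  qed
  have 2: "?f summable_on {..0}"
  proof (subst summable_on_reindex_bij_betw[symmetric])
    show "bij_betw (\<lambda>k. - int k) UNIV {..0}"
      by (rule bij_betwI[where g = "\<lambda>l. nat (- l)"]) auto
    have "?f (- int k) = ?h k" for k
    proof -
      have "\<bar>real_of_int (- int k) - 1 / 2\<bar> = real k + 1 / 2" by simp
      then show ?thesis by (simp only:)
    qed
    then show "(\<lambda>k. ?f (- int k)) summable_on UNIV" using h by (simp only:)
  qed
  have "UNIV = {1..} \<union> {..0::int}" by auto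
  then show ?thesis
    using summable_on_Un_disjoint[OF 1 2] by (simp add: Int_def)
qed

lemma inverse_norm_cubed_pole_le:
  "1 / norm (pole (l, m)) ^ 3
     \<le> \<bar>of_int l - 1 / 2\<bar> powr (- 3 / 2) * \<bar>of_int m - 1 / 2\<bar> powr (- 3 / 2)"
proof -
  define P where "P = norm (pole (l, m))"
  have P: "P > 0" using norm_pole_ge_half[of "(l, m)"] unfolding P_def by linarith
  define c where "c = \<bar>real_of_int l - 1 / 2\<bar> * \<bar>real_of_int m - 1 / 2\<bar>"
  have c: "c > 0" using half_le_abs_half_integer[of l] half_le_abs_half_integer[of m]
    by (auto simp: c_def intro!: mult_pos_pos)
  have "1 / P ^ 3 = P powr (- 3)" using P by (simp add: powr_minus_divide)
  also have "\<dots> = (P powr 2) powr (- 3 / 2)" by (simp add: powr_powr)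
  also have "P powr 2 = P\<^sup>2" using P by simp
  also have "(P\<^sup>2) powr (- 3 / 2) \<le> c powr (- 3 / 2)"
    using norm_square_pole_ge[of l m] c by (intro powr_mono2') (auto simp: P_def c_def)
  also have "\<dots> = \<bar>of_int l - 1 / 2\<bar> powr (- 3 / 2) * \<bar>of_int m - 1 / 2\<bar> powr (- 3 / 2)"
    by (simp add: c_def powr_mult)
  finally show ?thesis by (simp add: P_def)
qed

lemma summable_inverse_norm_cubed_pole:
  "(\<lambda>i. 1 / norm (pole i) ^ 3) summable_on UNIV"
proof -
  let ?f = "\<lambda>l::int. \<bar>real_of_int l - 1 / 2\<bar> powr (- 3 / 2)"
  have "(\<lambda>(l, m). ?f l * ?f m) summable_on (UNIV \<times> UNIV)"
  proof (rule summable_on_SigmaI[where g = "\<lambda>l. ?f l * (\<Sum>\<^sub>\<infinity>m. ?f m)"])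
    show "((\<lambda>m. case (l, m) of (l, m) \<Rightarrow> ?f l * ?f m) has_sum (?f l * (\<Sum>\<^sub>\<infinity>m. ?f m))) UNIV" for l
      unfolding prod.case by (intro has_sum_cmult_right has_sum_infsum summable_half_integer_powr)
    show "(\<lambda>l. ?f l * (\<Sum>\<^sub>\<infinity>m. ?f m)) summable_on UNIV"
      by (intro summable_on_cmult_left summable_half_integer_powr)
  qed auto
  then have "(\<lambda>(l, m). ?f l * ?f m) summable_on UNIV" by simp
  then show ?thesis
    by (rule summable_on_comparison_test) (use inverse_norm_cubed_pole_le in auto)
qed

section \<open>The averaged kernel and the twisted zeta function\<close>

text \<open>
The indices of the six shortest nonzero lattice vectors. These vectors are exactly the sixth roots
of -1, which is why averaging over them yields a kernel with the simple denominator w (w^6 + 1).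
\<close>
definition unit_indices :: "(int \<times> int) set" where
  "unit_indices = {(1,0), (1,-1), (0,-1), (-1,0), (-1,1), (0,1)}"

text \<open>
One has 1 / (w (w^6 + 1)) = 1 / w - (1/6) \<Sum> 1 / (w - s), the sum being over the sixth roots s of -1
(\<open>zeta_kernel_partial_fractions\<close>): the difference between 1 / w and its mean over the translates
by the shortest lattice vectors.
\<close>
definition zeta_kernel :: "complex \<Rightarrow> complex" where
  "zeta_kernel w = 1 / (w * (w ^ 6 + 1))"

text \<open>
The function with simple poles at the points \<open>pole i\<close> and residues \<open>chi i\<close>. Subtracting the mean
over the six translates multiplies the formal series \<Sum> chi i / (z - pole i) by
1 - (1/6) (-3) = 3/2, since the values of \<open>chi\<close> at the six indices add up to -3
(\<open>sum_chi_unit_indices\<close>); the factor 2/3 undoes this.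
\<close>
definition twisted_zeta :: "complex \<Rightarrow> complex" where
  "twisted_zeta z = 2 / 3 * (\<Sum>\<^sub>\<infinity>i. chi i * zeta_kernel (z - pole i))"

lemma uminus_in_unit_indices: "- i \<in> unit_indices \<longleftrightarrow> i \<in> unit_indices"
  by (cases i) (auto simp: unit_indices_def)

lemma zero_notin_unit_indices: "0 \<notin> unit_indices"
  by (auto simp: unit_indices_def zero_prod_def)

lemma finite_unit_indices: "finite unit_indices"
  by (simp add: unit_indices_def)

lemma lattice_point_units:
  "lattice_point (1, 0) = \<xi>" "lattice_point (1, - 1) = \<i>" "lattice_point (0, - 1) = - cnj \<xi>"
  "lattice_point (- 1, 0) = - \<xi>" "lattice_point (- 1, 1) = - \<i>" "lattice_point (0, 1) = cnj \<xi>"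
  using cnj_xi(2) by (simp_all add: lattice_point_def)

lemma lattice_point_unit_power6:
  assumes "i \<in> unit_indices" shows "lattice_point i ^ 6 = - 1"
proof -
  have "cnj \<xi> ^ 6 = - 1"
    using xi_power6 by (metis complex_cnj_minus complex_cnj_one complex_cnj_power)
  moreover have "\<i> ^ 6 = - 1" by (simp add: eval_nat_numeral)
  ultimately show ?thesis
    using assms by (auto simp: unit_indices_def lattice_point_units xi_power6)
qed

lemma sum_unit_indices:
  "(\<Sum>i\<in>unit_indices. f i) = f (1,0) + f (1,-1) + f (0,-1) + f (-1,0) + f (-1,1) + f (0,1)"
  for f :: "int \<times> int \<Rightarrow> 'a :: comm_monoid_add"
  by (simp add: unit_indices_def algebra_simps)

lemma prod_unit_indices:
  "(\<Prod>i\<in>unit_indices. f i) = f (1,0) * f (1,-1) * f (0,-1) * f (-1,0) * f (-1,1) * f (0,1)"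
  for f :: "int \<times> int \<Rightarrow> 'a :: comm_monoid_mult"
  by (simp add: unit_indices_def algebra_simps)

lemma sum_chi_unit_indices: "(\<Sum>i\<in>unit_indices. chi i) = - 3"
proof -
  have p: "\<omega> powi 2 = \<omega>\<^sup>2" "\<omega> powi 1 = \<omega>" "\<omega> powi (-1) = \<omega>\<^sup>2" "\<omega> powi (-2) = \<omega>"
    using omega_cubed inverse_omega
    by (simp_all add: power_int_minus power_inverse[symmetric] eval_nat_numeral) 
  show ?thesis
    unfolding sum_unit_indices chi_def using omega_sum p by simp
qed

lemma xi_sq_sum: "\<xi>\<^sup>2 + (cnj \<xi>)\<^sup>2 = 1" and xi_sq_prod: "\<xi>\<^sup>2 * (cnj \<xi>)\<^sup>2 = 1"
  by (simp_all add: \<xi>_def complex_eq_iff power2_eq_square)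

lemma power6_plus_1_factorization: "w ^ 6 + 1 = (\<Prod>i\<in>unit_indices. w - lattice_point i)"
proof -
  have "(\<Prod>i\<in>unit_indices. w - lattice_point i) = (w\<^sup>2 - \<xi>\<^sup>2) * (w\<^sup>2 - (cnj \<xi>)\<^sup>2) * (w\<^sup>2 + 1)"
    unfolding prod_unit_indices lattice_point_units by (simp add: power2_eq_square algebra_simps)
  also have "(w\<^sup>2 - \<xi>\<^sup>2) * (w\<^sup>2 - (cnj \<xi>)\<^sup>2)
      = w\<^sup>2 * w\<^sup>2 - (\<xi>\<^sup>2 + (cnj \<xi>)\<^sup>2) * w\<^sup>2 + \<xi>\<^sup>2 * (cnj \<xi>)\<^sup>2"
    by (simp only: algebra_simps)
  also have "\<dots> * (w\<^sup>2 + 1) = w ^ 6 + 1"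
    unfolding xi_sq_sum xi_sq_prod by (simp add: eval_nat_numeral algebra_simps)
  finally show ?thesis by simp
qed

text \<open>
The roots of w^6 + 1 come in pairs \<plusminus>s, and each pair contributes 2 w / (w^2 - s^2). With the squares
of the roots as parameters only symmetric functions of degree three remain.
\<close>
lemma zeta_kernel_partial_fractions:
  assumes "\<And>j. j \<in> insert 0 unit_indices \<Longrightarrow> w \<noteq> lattice_point j"
  shows "zeta_kernel w = 1 / w - 1 / 6 * (\<Sum>j\<in>unit_indices. 1 / (w - lattice_point j))"
proof -
  have w: "w \<noteq> 0" using assms[of 0] lattice_point_0 by simp
  have nz: "w - lattice_point j \<noteq> 0" if "j \<in> unit_indices" for j using assms[of j] that by simp
  have pair: "1 / (w - s) + 1 / (w + s) = 2 * w / (w\<^sup>2 - s\<^sup>2)"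
    if "w - s \<noteq> 0" "w + s \<noteq> 0" for s
    using add_frac_eq[OF that, of 1 1] by (simp add: power2_eq_square algebra_simps)
  have nz': "w - \<xi> \<noteq> 0" "w + \<xi> \<noteq> 0" "w - cnj \<xi> \<noteq> 0" "w + cnj \<xi> \<noteq> 0" "w - \<i> \<noteq> 0" "w + \<i> \<noteq> 0"
    using nz[of "(1,0)"] nz[of "(1,-1)"] nz[of "(0,-1)"] nz[of "(-1,0)"] nz[of "(-1,1)"] nz[of "(0,1)"]
    by (simp_all add: lattice_point_units unit_indices_def)
  define a b where "a = w\<^sup>2 - \<xi>\<^sup>2" and "b = w\<^sup>2 - (cnj \<xi>)\<^sup>2"
  define c where "c = w\<^sup>2 + 1"
  have c: "w\<^sup>2 - \<i>\<^sup>2 = c" by (simp add: c_def)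
  have nz2: "a \<noteq> 0" "b \<noteq> 0" "c \<noteq> 0"
    using nz' c unfolding a_def b_def square_diff_square_factored power2_eq_square by auto
  have ab: "a + b = 2 * w\<^sup>2 - 1" "a * b = w\<^sup>2 * w\<^sup>2 - w\<^sup>2 + 1"
  proof -
    show "a + b = 2 * w\<^sup>2 - 1" using xi_sq_sum by (simp add: a_def b_def algebra_simps)
    have "a * b = w\<^sup>2 * w\<^sup>2 - (\<xi>\<^sup>2 + (cnj \<xi>)\<^sup>2) * w\<^sup>2 + \<xi>\<^sup>2 * (cnj \<xi>)\<^sup>2"
      unfolding a_def b_def by (simp only: algebra_simps)
    then show "a * b = w\<^sup>2 * w\<^sup>2 - w\<^sup>2 + 1" unfolding xi_sq_sum xi_sq_prod by simp
  qed
  have "(\<Sum>j\<in>unit_indices. 1 / (w - lattice_point j)) =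
     (1 / (w - \<xi>) + 1 / (w + \<xi>)) + (1 / (w - cnj \<xi>) + 1 / (w + cnj \<xi>))
      + (1 / (w - \<i>) + 1 / (w + \<i>))"
    unfolding sum_unit_indices lattice_point_units by simp
  also have "\<dots> = 2 * w / a + 2 * w / b + 2 * w / c"
    using nz' c by (simp add: pair a_def b_def)
  also have "\<dots> = 2 * w * ((a + b) * c + a * b) / (a * b * c)"
    using nz2 by (simp add: divide_simps) (simp add: algebra_simps)
  also have "(a + b) * c + a * b = 3 * w ^ 4"
    unfolding ab c_def by (simp add: eval_nat_numeral algebra_simps)
  also have abc: "a * b * c = w ^ 6 + 1"
    unfolding ab c_def by (simp add: eval_nat_numeral algebra_simps)
  finally have sum: "(\<Sum>j\<in>unit_indices. 1 / (w - lattice_point j)) = 2 * w * (3 * w ^ 4) / (w ^ 6 + 1)" .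
  have "w ^ 6 + 1 \<noteq> 0" using nz2 abc by (metis mult_eq_0_iff)
  then show ?thesis unfolding sum zeta_kernel_def using w
    by (simp add: divide_simps) (simp add: eval_nat_numeral algebra_simps)
qed

section \<open>Uniform convergence\<close>

lemma norm_zeta_kernel_le_far:
  assumes "norm w \<ge> 2" shows "norm (zeta_kernel w) \<le> 1 / norm w ^ 3"
proof -
  define x where "x = norm w"
  have x: "x \<ge> 2" using assms x_def by simp
  have "x ^ 2 * 1 \<le> x ^ 2 * (x ^ 4 - 1)"
    using power_mono[OF x, of 4] by (intro mult_left_mono) auto
  also have "\<dots> = x ^ 6 - x ^ 2" by (simp add: algebra_simps power_add[symmetric])
  also have "\<dots> \<le> x ^ 6 - 1" using x by simp
  also have "\<dots> \<le> norm (w ^ 6 + 1)"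
    using norm_triangle_ineq2[of "w ^ 6" "- 1"] by (simp add: x_def norm_power)
  finally have *: "x ^ 2 \<le> norm (w ^ 6 + 1)" by simp
  have "norm (zeta_kernel w) = 1 / (x * norm (w ^ 6 + 1))"
    by (simp add: zeta_kernel_def norm_divide norm_mult x_def)
  also have "\<dots> \<le> 1 / (x * x ^ 2)"
    using * x by (intro divide_left_mono mult_left_mono mult_pos_pos) (auto intro: less_le_trans[of 0 "x^2"])
  finally show ?thesis by (simp add: x_def eval_nat_numeral)
qed

lemma norm_zeta_kernel_le_near:
  assumes "\<delta> > 0" "\<And>j. j \<in> insert 0 unit_indices \<Longrightarrow> norm (w - lattice_point j) \<ge> \<delta>"
  shows "norm (zeta_kernel w) \<le> 1 / \<delta> ^ 7"
proof -
  have "norm w \<ge> \<delta>" using assms(2)[of 0] by (simp add: lattice_point_0)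
  have "norm (w ^ 6 + 1) = (\<Prod>i\<in>unit_indices. norm (w - lattice_point i))"
    by (simp add: power6_plus_1_factorization prod_norm)
  also have "\<dots> \<ge> (\<Prod>i\<in>unit_indices. \<delta>)"
    using assms by (intro prod_mono) auto
  also have "(\<Prod>i\<in>unit_indices. \<delta>) = \<delta> ^ 6" by (simp add: unit_indices_def eval_nat_numeral)
  finally have "norm (w ^ 6 + 1) \<ge> \<delta> ^ 6" .
  with \<open>norm w \<ge> \<delta>\<close> have "\<delta> * \<delta> ^ 6 \<le> norm w * norm (w ^ 6 + 1)"
    using assms(1) by (intro mult_mono) auto
  moreover have "\<delta> * \<delta> ^ 6 > 0" using assms(1) by simp
  ultimately have "1 / (norm w * norm (w ^ 6 + 1)) \<le> 1 / (\<delta> * \<delta> ^ 6)"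
    by (intro frac_le order.refl zero_le_one) assumption+
  then show ?thesis by (simp add: zeta_kernel_def norm_divide norm_mult eval_nat_numeral)
qed

text \<open>
One majorant for all indices: far poles are covered by the decay of the kernel, and the finitely
many near ones by the distance \<delta> from the singularities, at the price of a large constant.
\<close>
lemma norm_zeta_kernel_translate_le:
  assumes "0 < \<delta>" "\<delta> \<le> 1" "1 \<le> R" "norm z \<le> R"
    and "\<And>j. j \<in> insert 0 unit_indices \<Longrightarrow> norm (z - pole i - lattice_point j) \<ge> \<delta>"
  shows "norm (zeta_kernel (z - pole i)) \<le> (2 * R + 4) ^ 3 / \<delta> ^ 7 * (1 / norm (pole i) ^ 3)"
proof -
  define x where "x = norm (pole i)"
  have x: "x > 0" using norm_pole_ge_half[of i] unfolding x_def by linarith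
  have d: "0 < \<delta> ^ 7" "\<delta> ^ 7 \<le> 1" using assms by (auto simp: power_le_one)
  show ?thesis
  proof (cases "x \<ge> 2 * R + 4")
    case True
    have "norm (z - pole i) \<ge> x - R"
      using norm_triangle_ineq3[of z "pole i"] assms(4) unfolding x_def by linarith
    then have w: "norm (z - pole i) \<ge> x / 2" "norm (z - pole i) \<ge> 2" using True assms(3) by auto
    have "norm (zeta_kernel (z - pole i)) \<le> 1 / norm (z - pole i) ^ 3"
      by (rule norm_zeta_kernel_le_far) (use w in auto)
    also have "\<dots> \<le> 1 / (x / 2) ^ 3"
      using w x by (intro divide_left_mono power_mono mult_pos_pos zero_less_power) auto
    also have "\<dots> = 2 ^ 3 / 1 * (1 / x ^ 3)" by (simp add: power_divide)
    also have "\<dots> \<le> (2 * R + 4) ^ 3 / \<delta> ^ 7 * (1 / x ^ 3)"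
      using d x assms(3) by (intro mult_right_mono frac_le power_mono) auto
    finally show ?thesis by (simp add: x_def)
  next
    case False
    have "norm (zeta_kernel (z - pole i)) \<le> 1 / \<delta> ^ 7"
      by (rule norm_zeta_kernel_le_near) (use assms in auto)
    also have "\<dots> = x ^ 3 / \<delta> ^ 7 * (1 / x ^ 3)" using x by simp
    also have "\<dots> \<le> (2 * R + 4) ^ 3 / \<delta> ^ 7 * (1 / x ^ 3)"
      using d x False by (intro mult_right_mono divide_right_mono power_mono) auto
    finally show ?thesis by (simp add: x_def)
  qed
qed

text \<open>
The hypotheses keep the region D away from the singularities of the summands with index in I. Around
a regular point I can be the set of all indices; around a pole the summands that are singular
there have to be left out.
\<close>
context
  fixes \<delta> R :: real and D :: "complex set" and I :: "(int \<times> int) set"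
  assumes \<delta>: "0 < \<delta>" "\<delta> \<le> 1" and R: "1 \<le> R"
    and D: "\<And>z. z \<in> D \<Longrightarrow> norm z \<le> R"
    and away: "\<And>z i j. z \<in> D \<Longrightarrow> i \<in> I \<Longrightarrow> j \<in> insert 0 unit_indices \<Longrightarrow> norm (z - pole i - lattice_point j) \<ge> \<delta>"
begin

lemma norm_summand_le:
  assumes "z \<in> D" "i \<in> I"
  shows "norm (chi i * zeta_kernel (z - pole i)) \<le> (2 * R + 4) ^ 3 / \<delta> ^ 7 * (1 / norm (pole i) ^ 3)"
  using norm_zeta_kernel_translate_le[OF \<delta> R D] assms away by (simp add: norm_mult norm_chi)

lemma majorant_summable:
  "(\<lambda>i. (2 * R + 4) ^ 3 / \<delta> ^ 7 * (1 / norm (pole i) ^ 3)) summable_on I"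
  by (intro summable_on_cmult_right summable_on_subset_banach[OF summable_inverse_norm_cubed_pole]) auto

lemma summand_summable:
  assumes "z \<in> D"
  shows "(\<lambda>i. chi i * zeta_kernel (z - pole i)) summable_on I"
proof (rule abs_summable_summable)
  show "(\<lambda>i. norm (chi i * zeta_kernel (z - pole i))) summable_on I"
    using majorant_summable by (rule summable_on_comparison_test) (use norm_summand_le assms in auto)
qed

lemma uniform_limit_summands:
  "uniform_limit D (\<lambda>X z. \<Sum>i\<in>X. chi i * zeta_kernel (z - pole i))
     (\<lambda>z. \<Sum>\<^sub>\<infinity>i\<in>I. chi i * zeta_kernel (z - pole i)) (finite_subsets_at_top I)"
  by (rule Weierstrass_m_test_general[OF norm_summand_le majorant_summable])

lemma holomorphic_summand:
  assumes "i \<in> I" shows "(\<lambda>z. chi i * zeta_kernel (z - pole i)) holomorphic_on D"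
proof -
  have "(z - pole i) * ((z - pole i) ^ 6 + 1) \<noteq> 0" if "z \<in> D" for z
  proof -
    have "z - pole i - lattice_point j \<noteq> 0" if "j \<in> insert 0 unit_indices" for j
      using away[OF \<open>z \<in> D\<close> assms that] \<delta> by auto
    moreover from this[of 0] have "z - pole i \<noteq> 0" by (simp add: lattice_point_0)
    ultimately show ?thesis
      using finite_unit_indices unfolding power6_plus_1_factorization by auto
  qed
  then show ?thesis unfolding zeta_kernel_def by (intro holomorphic_intros) auto
qed

lemma holomorphic_finite_sum:
  "eventually (\<lambda>X. (\<lambda>z. \<Sum>i\<in>X. chi i * zeta_kernel (z - pole i)) holomorphic_on D) (finite_subsets_at_top I)"
  by (rule eventually_finite_subsets_at_top_weakI) (auto intro!: holomorphic_on_sum holomorphic_summand)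

lemma holomorphic_infinite_sum:
  assumes "open D"
  shows "(\<lambda>z. \<Sum>\<^sub>\<infinity>i\<in>I. chi i * zeta_kernel (z - pole i)) holomorphic_on D"
  unfolding holomorphic_on_def
proof
  fix z assume "z \<in> D"
  then obtain r where r: "r > 0" "cball z r \<subseteq> D" using assms by (meson open_contains_cball)
  have "(\<lambda>z. \<Sum>\<^sub>\<infinity>i\<in>I. chi i * zeta_kernel (z - pole i)) holomorphic_on ball z r"
  proof (rule holomorphic_uniform_limit)
    show "uniform_limit (cball z r) (\<lambda>X z. \<Sum>i\<in>X. chi i * zeta_kernel (z - pole i))
       (\<lambda>z. \<Sum>\<^sub>\<infinity>i\<in>I. chi i * zeta_kernel (z - pole i)) (finite_subsets_at_top I)"
      using uniform_limit_summands r(2) by (rule uniform_limit_on_subset)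
    show "\<forall>\<^sub>F X in finite_subsets_at_top I.
       continuous_on (cball z r) (\<lambda>z. \<Sum>i\<in>X. chi i * zeta_kernel (z - pole i)) \<and>
       (\<lambda>z. \<Sum>i\<in>X. chi i * zeta_kernel (z - pole i)) holomorphic_on ball z r"
      using holomorphic_finite_sum
    proof eventually_elim
      case (elim X)
      then show ?case using r(2) ball_subset_cball
        by (meson holomorphic_on_imp_continuous_on holomorphic_on_subset)
    qed
  qed auto
  then show "(\<lambda>z. \<Sum>\<^sub>\<infinity>i\<in>I. chi i * zeta_kernel (z - pole i)) field_differentiable at z within D"
    using r(1) \<open>z \<in> D\<close>
    by (meson centre_in_ball field_differentiable_at_within holomorphic_on_imp_differentiable_at open_ball)
qed

end

section \<open>Symmetries under translation, rotation and conjugation\<close>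

lemma infsum_translate:
  "(\<Sum>\<^sub>\<infinity>i. f (i + j)) = (\<Sum>\<^sub>\<infinity>i. f i)" for f :: "int \<times> int \<Rightarrow> complex"
proof (rule infsum_reindex_bij_betw)
  show "bij_betw (\<lambda>i. i + j) UNIV UNIV"
    by (rule bij_betwI[where g = "\<lambda>i. i - j"]) auto
qed

text \<open>
Reindexing the series. The identity holds at the poles as well, for the values that division by
zero assigns there, since it compares the two series term by term.
\<close>
theorem twisted_zeta_translate: "twisted_zeta (z + lattice_point j) = chi j * twisted_zeta z"
proof -
  have "(\<Sum>\<^sub>\<infinity>i. chi i * zeta_kernel (z + lattice_point j - pole i)) =
        (\<Sum>\<^sub>\<infinity>i. chi (i + j) * zeta_kernel (z + lattice_point j - pole (i + j)))"
    using infsum_translate[of "\<lambda>i. chi i * zeta_kernel (z + lattice_point j - pole i)"] by simp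
  also have "\<dots> = (\<Sum>\<^sub>\<infinity>i. chi j * (chi i * zeta_kernel (z - pole i)))"
    by (simp add: chi_add pole_add algebra_simps)
  also have "\<dots> = chi j * (\<Sum>\<^sub>\<infinity>i. chi i * zeta_kernel (z - pole i))"
    by (rule infsum_cmult_right')
  finally show ?thesis by (simp add: twisted_zeta_def)
qed

lemma zeta_kernel_rotate: "zeta_kernel (\<omega> * w) = \<omega>\<^sup>2 * zeta_kernel w"
proof -
  have "(\<omega> * w) ^ 6 = (\<omega> ^ 3) ^ 2 * w ^ 6" by (simp add: power_mult_distrib)
  then have "(\<omega> * w) ^ 6 = w ^ 6" by (simp add: omega_cubed)
  then show ?thesis
    unfolding inverse_omega[symmetric] by (simp add: zeta_kernel_def field_simps)
qed

text \<open>
Multiplication by \<omega> maps the lattice to itself; this is its effect on the coordinates.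
\<close>
definition rotate_index :: "int \<times> int \<Rightarrow> int \<times> int" where
  "rotate_index i = (snd i, - fst i - snd i)"

lemma lattice_point_rotate_index: "lattice_point (rotate_index i) = \<omega> * lattice_point i"
proof -
  have "\<omega> * \<xi> = - cnj \<xi>" "\<omega> * cnj \<xi> = \<xi> - cnj \<xi>"
    by (simp_all add: \<omega>_def \<xi>_def complex_eq_iff)
  then have "\<omega> * lattice_point i = of_int (fst i) * (- cnj \<xi>) + of_int (snd i) * (\<xi> - cnj \<xi>)"
    by (simp only: lattice_point_def distrib_left mult.left_commute[of \<omega>])
  then show ?thesis by (simp add: rotate_index_def lattice_point_def algebra_simps)
qed

text \<open>
The exponents of \<omega> in \<open>chi\<close> at an index and at its image differ by a multiple of 3.
\<close>
lemma chi_rotate_index: "chi (rotate_index i) = chi i"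
proof -
  have "chi i = \<omega> powi ((2 * fst (rotate_index i) + snd (rotate_index i)) + 3 * fst i)"
    by (simp add: chi_def rotate_index_def algebra_simps)
  also have "\<dots> = chi (rotate_index i) * (\<omega> powi 3) powi (fst i)"
    by (simp only: power_int_add[OF disjI1[OF omega_nonzero]] chi_def power_int_mult)
  also have "\<omega> powi 3 = 1" using omega_cubed by simp
  finally show ?thesis by simp
qed

theorem twisted_zeta_rotate: "twisted_zeta (pole 0 + \<omega> * u) = \<omega>\<^sup>2 * twisted_zeta (pole 0 + u)"
proof -
  have bij: "bij_betw rotate_index UNIV UNIV"
    by (rule bij_betwI[where g = "\<lambda>i. (- fst i - snd i, fst i)"]) (auto simp: rotate_index_def)
  have p: "pole i = pole 0 + lattice_point i" for i using pole_add[of 0 i] by simp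
  have "(\<Sum>\<^sub>\<infinity>i. chi i * zeta_kernel (\<omega> * u - lattice_point i)) = (\<Sum>\<^sub>\<infinity>i. chi (rotate_index i) * zeta_kernel (\<omega> * u - lattice_point (rotate_index i)))"
    by (rule infsum_reindex_bij_betw[OF bij, symmetric])
  also have "\<dots> = (\<Sum>\<^sub>\<infinity>i. \<omega>\<^sup>2 * (chi i * zeta_kernel (u - lattice_point i)))"
    by (simp add: chi_rotate_index lattice_point_rotate_index zeta_kernel_rotate right_diff_distrib[symmetric] mult_ac)
  also have "\<dots> = \<omega>\<^sup>2 * (\<Sum>\<^sub>\<infinity>i. chi i * zeta_kernel (u - lattice_point i))"
    by (rule infsum_cmult_right')
  finally show ?thesis unfolding twisted_zeta_def by (subst (1 2) p) simp
qed

theorem twisted_zeta_cnj: "twisted_zeta (cnj z) = cnj (twisted_zeta z)"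
proof -
  have bij: "bij_betw prod.swap UNIV (UNIV :: (int \<times> int) set)"
    by (rule bij_betwI[where g = prod.swap]) auto
  have chi: "chi (prod.swap i) = cnj (chi i)" for i
  proof -
    have "cnj (chi i) = cnj \<omega> powi (2 * fst i + snd i)"
      unfolding chi_def by (auto simp: power_int_def)
    also have "cnj \<omega> = inverse \<omega>" by (simp only: cnj_omega inverse_omega)
    also have "\<dots> powi (2 * fst i + snd i) = inverse (\<omega> powi (2 * fst i + snd i))"
      by (simp add: power_int_inverse)
    also have "\<dots> = \<omega> powi (- (2 * fst i + snd i))"
      by (simp only: power_int_minus)
    also have "\<dots> = \<omega> powi ((2 * snd i + fst i) + 3 * (- fst i - snd i))"
      by (simp add: algebra_simps)
    also have "\<dots> = chi (prod.swap i) * (\<omega> powi 3) powi (- fst i - snd i)"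
      by (simp only: power_int_add[OF disjI1[OF omega_nonzero]] chi_def power_int_mult fst_swap snd_swap)
    also have "\<omega> powi 3 = 1" using omega_cubed by simp
    finally show ?thesis by simp
  qed
  have "pole (prod.swap i) = cnj (pole i)" for i by (simp add: pole_def lattice_point_def)
  moreover have "zeta_kernel (cnj w) = cnj (zeta_kernel w)" for w by (simp add: zeta_kernel_def)
  ultimately have eq: "chi (prod.swap i) * zeta_kernel (cnj z - pole (prod.swap i)) = cnj (chi i * zeta_kernel (z - pole i))" for i
    using chi by (metis complex_cnj_diff complex_cnj_mult)
  have "(\<Sum>\<^sub>\<infinity>i. chi i * zeta_kernel (cnj z - pole i)) = (\<Sum>\<^sub>\<infinity>i. cnj (chi i * zeta_kernel (z - pole i)))"
    using infsum_reindex_bij_betw[OF bij, of "\<lambda>i. chi i * zeta_kernel (cnj z - pole i)"] by (simp only: eq)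
  also have "\<dots> = cnj (\<Sum>\<^sub>\<infinity>i. chi i * zeta_kernel (z - pole i))" by (simp only: infsum_cnj)
  finally show ?thesis by (simp add: twisted_zeta_def)
qed

section \<open>Behaviour at the poles\<close>

lemma pole_eq_translate: "pole i = pole 0 + lattice_point i"
  using pole_add[of 0 i] by simp

lemma uminus_pole: "- pole i = pole ((1, 1) - i)"
  by (simp add: pole_def lattice_point_def \<xi>_def complex_eq_iff algebra_simps)

lemma uminus_notin_poles: "- z \<notin> range pole \<longleftrightarrow> z \<notin> range pole"
  by (metis minus_minus rangeE rangeI uminus_pole)

lemma translate_notin_poles: "z + lattice_point j \<notin> range pole \<longleftrightarrow> z \<notin> range pole"
proof -
  have "z + lattice_point j \<in> range pole \<longleftrightarrow> z \<in> range pole" for z j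
  proof
    assume "z + lattice_point j \<in> range pole"
    then obtain i where "z + lattice_point j = pole i" by auto
    then have "z = pole (i - j)" by (simp add: pole_def lattice_point_diff algebra_simps)
    then show "z \<in> range pole" by simp
  next
    assume "z \<in> range pole"
    then obtain i where "z = pole i" by auto
    then have "z + lattice_point j = pole (i + j)" by (simp add: pole_add)
    then show "z + lattice_point j \<in> range pole" by simp
  qed
  then show ?thesis by simp
qed

lemma small_notin_poles: "norm z < 1 / 2 \<Longrightarrow> z \<notin> range pole"
  using norm_pole_ge_half by (metis linorder_not_less rangeE)

lemma closed_poles: "closed (range pole)"
proof (rule discrete_imp_closed[of 1])
  show "\<forall>x\<in>range pole. \<forall>y\<in>range pole. dist y x < 1 \<longrightarrow> y = x"
  proof (clarify)
    fix i j assume d: "dist (pole j) (pole i) < 1"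
    have "pole j - pole i = lattice_point (j - i)" by (simp add: pole_def lattice_point_diff)
    then have "norm (lattice_point (j - i)) < 1" using d by (simp add: dist_norm)
    then have "j - i = 0" using norm_lattice_point_ge_1 by (metis linorder_not_less)
    then show "pole j = pole i" by simp
  qed
qed simp

text \<open>
The poles form a closed discrete set, so around every regular point there is a ball on which the
distances to all singularities of the summands are bounded below.
\<close>
lemma twisted_zeta_holomorphic: "twisted_zeta holomorphic_on - range pole"
  unfolding holomorphic_on_def
proof
  fix z assume "z \<in> - range pole"
  then obtain r where r: "r > 0" "ball z r \<subseteq> - range pole"
    using closed_poles by (meson open_Compl open_contains_ball)
  define \<delta> where "\<delta> = min 1 (r / 2)"
  have \<delta>: "0 < \<delta>" "\<delta> \<le> 1" "\<delta> \<le> r / 2" using r by (auto simp: \<delta>_def)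
  have "(\<lambda>z. \<Sum>\<^sub>\<infinity>i. chi i * zeta_kernel (z - pole i)) holomorphic_on ball z \<delta>"
  proof (rule holomorphic_infinite_sum[OF \<delta>(1,2)])
    show "1 \<le> norm z + 1" by simp
    show "norm w \<le> norm z + 1" if "w \<in> ball z \<delta>" for w
      using that \<delta>(2) norm_triangle_ineq2[of w z] by (simp add: dist_norm norm_minus_commute)
    show "\<delta> \<le> norm (w - pole i - lattice_point j)" if "w \<in> ball z \<delta>" for w i j
    proof (rule ccontr)
      assume "\<not> \<delta> \<le> norm (w - pole i - lattice_point j)"
      then have "dist w (pole (i + j)) < \<delta>" by (simp add: dist_norm pole_add algebra_simps)
      then have "dist z (pole (i + j)) < r"
        using that \<delta>(3) dist_triangle[of z "pole (i + j)" w] by simp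
      then have "pole (i + j) \<in> ball z r" by simp
      then show False using r(2) by blast
    qed
  qed simp
  then have "twisted_zeta holomorphic_on ball z \<delta>"
    unfolding twisted_zeta_def by (intro holomorphic_intros)
  then show "twisted_zeta field_differentiable at z within - range pole"
    using \<delta>(1) by (meson centre_in_ball field_differentiable_at_within holomorphic_on_imp_differentiable_at open_ball)
qed

text \<open>
Near the pole of index 0 the kernel is singular only in the summand of index 0 and, since the kernel
itself has poles at the shortest lattice vectors, in the six summands of the unit indices.
\<close>
lemma twisted_zeta_split_at_pole:
  obtains T where "T holomorphic_on ball 0 (1 / 2)"
    "\<And>u. u \<in> ball 0 (1 / 2) \<Longrightarrow>
       twisted_zeta (pole 0 + u) = 2 / 3 * (zeta_kernel u + (\<Sum>i\<in>unit_indices. chi i * zeta_kernel (u - lattice_point i)) + T u)"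
proof -
  define I where "I = - insert 0 unit_indices"
  define T where "T = (\<lambda>u. \<Sum>\<^sub>\<infinity>i\<in>I. chi i * zeta_kernel (pole 0 + u - pole i))"
  have "norm (pole 0) < 1"
    using real_sqrt_less_mono[of 3 4] by (simp add: pole_def lattice_point_0 norm_divide)
  then have D: "norm z \<le> 2" if "z \<in> ball (pole 0) (1 / 2)" for z
    using that norm_triangle_ineq2[of z "pole 0"] by (simp add: dist_norm norm_minus_commute)
  have away: "1 / 2 \<le> norm (z - pole i - lattice_point j)"
    if z: "z \<in> ball (pole 0) (1 / 2)" and i: "i \<in> I" and j: "j \<in> insert 0 unit_indices" for z i j
  proof -
    have "i + j \<noteq> 0" using i j uminus_in_unit_indices[of i] by (auto simp: I_def add_eq_0_iff)
    then have "1 \<le> norm (lattice_point (i + j))" by (rule norm_lattice_point_ge_1)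
    moreover have "z - pole i - lattice_point j = (z - pole 0) - lattice_point (i + j)"
      by (simp add: pole_eq_translate[of i] lattice_point_add algebra_simps)
    moreover have "norm (z - pole 0) < 1 / 2" using z by (simp add: dist_norm norm_minus_commute)
    ultimately show ?thesis
      using norm_triangle_ineq3[of "z - pole 0" "lattice_point (i + j)"] by (simp only: abs_le_iff) linarith
  qed
  have "(\<lambda>z. \<Sum>\<^sub>\<infinity>i\<in>I. chi i * zeta_kernel (z - pole i)) holomorphic_on ball (pole 0) (1 / 2)"
    by (rule holomorphic_infinite_sum[of "1 / 2" 2]) (use D away in auto)
  then have "(\<lambda>z. \<Sum>\<^sub>\<infinity>i\<in>I. chi i * zeta_kernel (z - pole i)) \<circ> (\<lambda>u. pole 0 + u) holomorphic_on ball 0 (1 / 2)"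
    by (intro holomorphic_on_compose_gen[where t = "ball (pole 0) (1 / 2)"] holomorphic_intros)
       (auto simp: dist_norm)
  then have 1: "T holomorphic_on ball 0 (1 / 2)" by (simp add: T_def o_def)
  have 2: "twisted_zeta (pole 0 + u) = 2 / 3 * (zeta_kernel u + (\<Sum>i\<in>unit_indices. chi i * zeta_kernel (u - lattice_point i)) + T u)"
    if "u \<in> ball 0 (1 / 2)" for u
  proof -
    let ?f = "\<lambda>i. chi i * zeta_kernel (pole 0 + u - pole i)"
    have translate: "pole 0 + u - pole i = u - lattice_point i" for i
      by (subst pole_eq_translate[of i]) simp
    have I: "?f summable_on I"
      by (rule summand_summable[of "1 / 2" 2 "ball (pole 0) (1 / 2)"])
         (use D away that in \<open>auto simp: dist_norm\<close>)
    have "infsum ?f UNIV = infsum ?f (insert 0 unit_indices \<union> I)" by (simp add: I_def Un_commute)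
    also have "\<dots> = infsum ?f (insert 0 unit_indices) + infsum ?f I"
      by (rule infsum_Un_disjoint[OF summable_on_finite I]) (simp_all add: I_def finite_unit_indices)
    also have "infsum ?f (insert 0 unit_indices) = sum ?f (insert 0 unit_indices)"
      using finite_unit_indices by simp
    also have "\<dots> = ?f 0 + sum ?f unit_indices" using finite_unit_indices zero_notin_unit_indices by simp
    also have "\<dots> = zeta_kernel u + (\<Sum>i\<in>unit_indices. chi i * zeta_kernel (u - lattice_point i))"
      by (simp add: translate chi_0 lattice_point_0)
    finally show ?thesis by (simp add: twisted_zeta_def T_def)
  qed
  show ?thesis using that 1 2 by blast
qed

text \<open>
With s^6 = -1 the polynomial (u + s)^6 + 1 is u times a polynomial in u with value 6 s^5 at 0, so
the residue is 1 / (s * 6 s^5) = -1/6.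
\<close>
lemma zeta_kernel_residue_unit:
  assumes "i \<in> unit_indices"
  shows "((\<lambda>u. u * zeta_kernel (u - lattice_point i)) \<longlongrightarrow> - 1 / 6) (at 0)"
proof -
  define s where "s = - lattice_point i"
  have s: "s ^ 6 = - 1" using lattice_point_unit_power6[OF assms] by (simp add: s_def)
  define q where "q u = u ^ 5 + 6 * u ^ 4 * s + 15 * u ^ 3 * s\<^sup>2 + 20 * u\<^sup>2 * s ^ 3 + 15 * u * s ^ 4 + 6 * s ^ 5"
    for u :: complex
  have q: "(u + s) ^ 6 + 1 = u * q u" for u
  proof -
    have "(u + s) ^ 6 = u * q u + s ^ 6"
      by (simp add: q_def eval_nat_numeral algebra_simps)
    then show ?thesis by (simp add: s)
  qed
  have s6: "(0 + s) * q 0 = - 6" using s by (simp add: q_def eval_nat_numeral)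
  have "((\<lambda>u. 1 / ((u + s) * q u)) \<longlongrightarrow> 1 / ((0 + s) * q 0)) (at 0)"
    using s6 unfolding q_def by (intro tendsto_intros) (metis neg_equal_0_iff_equal zero_neq_numeral)
  then have "((\<lambda>u. 1 / ((u + s) * q u)) \<longlongrightarrow> - 1 / 6) (at 0)" unfolding s6 by simp
  then show ?thesis
  proof (rule Lim_transform_eventually)
    have "\<forall>\<^sub>F u in at (0::complex). u \<noteq> 0" by (simp add: eventually_at_filter)
    then show "\<forall>\<^sub>F u in at 0. 1 / ((u + s) * q u) = u * zeta_kernel (u - lattice_point i)"
    proof eventually_elim
      case (elim u)
      have "u * zeta_kernel (u - lattice_point i) = u / ((u + s) * (u * q u))"
        by (simp add: zeta_kernel_def s_def flip: q)
      also have "\<dots> = 1 / ((u + s) * q u)" using elim by simp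
      finally show ?case by simp
    qed
  qed
qed

lemma twisted_zeta_residue: "((\<lambda>u. u * twisted_zeta (pole 0 + u)) \<longlongrightarrow> 1) (at 0)"
proof -
  obtain T where T: "T holomorphic_on ball 0 (1 / 2)"
    "\<And>u. u \<in> ball 0 (1 / 2) \<Longrightarrow>
       twisted_zeta (pole 0 + u) = 2 / 3 * (zeta_kernel u + (\<Sum>i\<in>unit_indices. chi i * zeta_kernel (u - lattice_point i)) + T u)"
    using twisted_zeta_split_at_pole by blast
  have T0: "(T \<longlongrightarrow> T 0) (at 0)"
    using T(1) by (metis centre_in_ball continuous_on_interior holomorphic_on_imp_continuous_on
        interior_ball isCont_def zero_less_divide_1_iff zero_less_numeral)
  have "((\<lambda>u. 1 / (u ^ 6 + 1)) \<longlongrightarrow> 1 / (0 ^ 6 + 1)) (at (0::complex))"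
    by (intro tendsto_intros) auto
  then have "((\<lambda>u. 2 / 3 * (1 / (u ^ 6 + 1) + (\<Sum>i\<in>unit_indices. chi i * (u * zeta_kernel (u - lattice_point i))) + u * T u))
      \<longlongrightarrow> 2 / 3 * (1 / (0 ^ 6 + 1) + (\<Sum>i\<in>unit_indices. chi i * (- 1 / 6)) + 0 * T 0)) (at 0)"
    by (intro tendsto_intros zeta_kernel_residue_unit T0) auto
  moreover have "(\<Sum>i\<in>unit_indices. chi i * (- 1 / 6)) = 1 / 2"
    unfolding sum_distrib_right[symmetric] sum_chi_unit_indices by simp
  then have "2 / 3 * (1 / (0 ^ 6 + 1) + (\<Sum>i\<in>unit_indices. chi i * (- 1 / 6)) + 0 * T 0) = 1"
    by (simp only:) simp
  ultimately have "((\<lambda>u. 2 / 3 * (1 / (u ^ 6 + 1) + (\<Sum>i\<in>unit_indices. chi i * (u * zeta_kernel (u - lattice_point i))) + u * T u))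
      \<longlongrightarrow> 1) (at 0)" by (simp only:)
  then show ?thesis
  proof (rule Lim_transform_eventually)
    have "\<forall>\<^sub>F u in at (0::complex). u \<in> ball 0 (1 / 2) - {0}"
      by (rule eventually_at_in_open) auto
    then show "\<forall>\<^sub>F u in at 0. 2 / 3 * (1 / (u ^ 6 + 1) + (\<Sum>i\<in>unit_indices. chi i * (u * zeta_kernel (u - lattice_point i))) + u * T u)
        = u * twisted_zeta (pole 0 + u)"
    proof eventually_elim
      case (elim u)
      then have "u * zeta_kernel u = 1 / (u ^ 6 + 1)" by (simp add: zeta_kernel_def)
      moreover have "u * (\<Sum>i\<in>unit_indices. chi i * zeta_kernel (u - lattice_point i)) = (\<Sum>i\<in>unit_indices. chi i * (u * zeta_kernel (u - lattice_point i)))"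
        by (simp add: sum_distrib_left mult_ac)
      moreover have "u * twisted_zeta (pole 0 + u) =
          2 / 3 * (u * zeta_kernel u + u * (\<Sum>i\<in>unit_indices. chi i * zeta_kernel (u - lattice_point i)) + u * T u)"
        using T(2)[of u] elim by (simp add: algebra_simps)
      ultimately show ?case by simp
    qed
  qed
qed

lemma pole_0_translate_notin_poles:
  assumes "u \<in> ball 0 (1 / 2) - {0}" shows "pole 0 + u \<notin> range pole"
proof
  assume "pole 0 + u \<in> range pole"
  then obtain i where "pole 0 + u = pole i" by auto
  then have "u = lattice_point i" by (simp add: pole_def lattice_point_0)
  then show False using assms norm_lattice_point_ge_1[of i] lattice_point_0 by auto
qed

text \<open>
Put k(u) = u Z(p + u), extended by its limit 1 at 0. Rotational symmetry of Z about the pole p says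
k(\<omega> u) = k(u), hence k'(0) = 0, and k(u) - 1 is divisible by u^2. The missing constant term in
the expansion of Z is what makes the differential equation hold at the poles.
\<close>
lemma twisted_zeta_expansion_at_pole:
  obtains m where "m holomorphic_on ball 0 (1 / 2)"
    "\<And>u. u \<in> ball 0 (1 / 2) - {0} \<Longrightarrow> twisted_zeta (pole 0 + u) = 1 / u + u * m u"
proof -
  let ?B = "ball (0::complex) (1 / 2)"
  define k where "k u = (if u = 0 then 1 else u * twisted_zeta (pole 0 + u))" for u
  have "(\<lambda>u. u * twisted_zeta (pole 0 + u)) holomorphic_on ?B - {0}"
  proof -
    have "(\<lambda>u. pole 0 + u) ` (?B - {0}) \<subseteq> - range pole"
      using pole_0_translate_notin_poles by (intro image_subsetI) blast
    then have "twisted_zeta \<circ> (\<lambda>u. pole 0 + u) holomorphic_on ?B - {0}"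
      by (intro holomorphic_on_compose_gen[OF _ twisted_zeta_holomorphic] holomorphic_intros)
    then show ?thesis by (intro holomorphic_intros) (simp add: o_def)
  qed
  then have "k holomorphic_on ?B - {0}"
    by (rule holomorphic_transform) (auto simp: k_def)
  moreover have klim: "(k \<longlongrightarrow> k 0) (at 0)"
  proof -
    have "\<forall>\<^sub>F u in at 0. u * twisted_zeta (pole 0 + u) = k u"
      by (auto simp: k_def eventually_at_filter)
    then have "(k \<longlongrightarrow> 1) (at 0)" by (rule Lim_transform_eventually[OF twisted_zeta_residue])
    moreover have "k 0 = 1" by (simp add: k_def)
    ultimately show ?thesis by (simp only:)
  qed
  moreover have "at 0 within ?B = at 0" by (rule at_within_open) auto
  ultimately have k: "k holomorphic_on ?B"
    using no_isolated_singularity'[of "{0}" k ?B] by (metis finite.emptyI finite.insertI open_ball singletonD)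
  have rot: "k (\<omega> * u) = k u" for u
  proof -
    have "\<omega> * u * (\<omega>\<^sup>2 * twisted_zeta (pole 0 + u)) = \<omega> ^ 3 * (u * twisted_zeta (pole 0 + u))"
      by (simp add: eval_nat_numeral)
    then show ?thesis using omega_nonzero by (auto simp: k_def twisted_zeta_rotate omega_cubed)
  qed
  have dk: "deriv k 0 = 0"
  proof -
    have d: "(k has_field_derivative deriv k 0) (at 0)"
      using k by (rule holomorphic_derivI) auto
    have "((\<lambda>u. k (\<omega> * u)) has_field_derivative deriv k 0 * \<omega>) (at 0)"
      by (rule DERIV_chain2[of k]) (use d in \<open>auto intro!: derivative_eq_intros\<close>)
    then have "deriv k 0 * \<omega> = deriv k 0" unfolding rot using d by (rule DERIV_unique)
    then show ?thesis using omega_neq_1 by simp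
  qed
  \<comment> \<open>Dividing out the zero at the origin twice, first from k - 1, then from the quotient.\<close>
  define k1 where "k1 = (\<lambda>u. if u = 0 then deriv k 0 else (k u - k 0) / (u - 0))"
  have k1: "k1 holomorphic_on ?B" unfolding k1_def by (rule pole_lemma[OF k]) simp
  define m where "m = (\<lambda>u. if u = 0 then deriv k1 0 else (k1 u - k1 0) / (u - 0))"
  have m: "m holomorphic_on ?B" unfolding m_def by (rule pole_lemma[OF k1]) simp
  have "twisted_zeta (pole 0 + u) = 1 / u + u * m u" if "u \<in> ?B - {0}" for u
  proof -
    have "u * m u = k1 u" using that by (simp add: m_def k1_def dk)
    also have "\<dots> = (u * twisted_zeta (pole 0 + u) - 1) / u" using that by (simp add: k1_def k_def)
    finally show ?thesis using that by (simp add: diff_divide_distrib)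
  qed
  then show ?thesis using that m by blast
qed

section \<open>The differential equation\<close>

text \<open>
The amount by which \<open>twisted_zeta\<close> fails to satisfy Z'(z) = - Z(-z)^2.
\<close>
definition ode_defect :: "complex \<Rightarrow> complex" where
  "ode_defect z = deriv twisted_zeta z + (twisted_zeta (- z))\<^sup>2"

lemma chi_cubed: "chi i ^ 3 = 1"
proof -
  have "chi i ^ 3 = (\<omega> powi 3) powi (2 * fst i + snd i)"
    unfolding chi_def by (metis mult.commute power_int_mult power_int_power power_int_numeral of_nat_numeral)
  then show ?thesis using omega_cubed by simp
qed

lemma open_regular: "open (- range pole)"
  using closed_poles by blast

lemma twisted_zeta_has_field_derivative:
  "z \<notin> range pole \<Longrightarrow> (twisted_zeta has_field_derivative deriv twisted_zeta z) (at z)"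
  using holomorphic_derivI[OF twisted_zeta_holomorphic open_regular] by simp

lemma deriv_twisted_zeta_translate:
  assumes "z \<notin> range pole" shows "deriv twisted_zeta (z + lattice_point j) = chi j * deriv twisted_zeta z"
proof -
  have "z + lattice_point j \<notin> range pole" using assms translate_notin_poles by simp
  then have "((\<lambda>w. twisted_zeta (w + lattice_point j)) has_field_derivative deriv twisted_zeta (z + lattice_point j)) (at z)"
    by (intro DERIV_shift[THEN iffD1] twisted_zeta_has_field_derivative)
  then have "((\<lambda>w. chi j * twisted_zeta w) has_field_derivative deriv twisted_zeta (z + lattice_point j)) (at z)"
    by (simp only: twisted_zeta_translate)
  moreover have "((\<lambda>w. chi j * twisted_zeta w) has_field_derivative chi j * deriv twisted_zeta z) (at z)"
    by (intro DERIV_cmult twisted_zeta_has_field_derivative assms)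
  ultimately show ?thesis by (rule DERIV_unique)
qed

text \<open>
The second term acquires the factor \<open>chi j\<close> to the power -2, which is \<open>chi j\<close> because \<open>chi\<close> takes its
values in the cube roots of unity; so both terms have the same multiplier.
\<close>
lemma ode_defect_translate:
  assumes "z \<notin> range pole" shows "ode_defect (z + lattice_point j) = chi j * ode_defect z"
proof -
  have "twisted_zeta (- (z + lattice_point j)) = inverse (chi j) * twisted_zeta (- z)"
    using twisted_zeta_translate[of "- z" "- j"] by (simp add: lattice_point_minus chi_minus algebra_simps)
  then have "(twisted_zeta (- (z + lattice_point j)))\<^sup>2 = (inverse (chi j))\<^sup>2 * (twisted_zeta (- z))\<^sup>2"
    by (simp add: power_mult_distrib)
  also have "(inverse (chi j))\<^sup>2 = chi j"
    using chi_cubed[of j] chi_nonzero[of j] by (simp add: field_simps eval_nat_numeral)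
  finally show ?thesis
    using assms by (simp add: ode_defect_def deriv_twisted_zeta_translate algebra_simps)
qed

lemma ode_defect_holomorphic: "ode_defect holomorphic_on - range pole"
proof -
  have "uminus ` (- range pole) \<subseteq> - range pole"
    using uminus_notin_poles by (intro image_subsetI) blast
  then have "twisted_zeta \<circ> uminus holomorphic_on - range pole"
    by (intro holomorphic_on_compose_gen[OF _ twisted_zeta_holomorphic] holomorphic_on_minus holomorphic_on_ident)
  then have "(\<lambda>z. twisted_zeta (- z)) holomorphic_on - range pole" by (simp add: o_def)
  then show ?thesis
    unfolding ode_defect_def
    by (intro holomorphic_on_add holomorphic_on_power holomorphic_deriv twisted_zeta_holomorphic open_regular)
qed

text \<open>
Both Z'(z) and Z(-z)^2 have a double pole and no simple pole, and their principal parts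
- 1 / u^2 and 1 / u^2 cancel. By quasi-periodicity it suffices to see this at the pole of index 0,
whose negative is a translate of it by a vector where \<open>chi\<close> is 1.
\<close>
lemma ode_defect_limit_at_pole: "\<exists>c. (ode_defect \<longlongrightarrow> c) (at (pole i))"
proof -
  let ?B = "ball (0::complex) (1 / 2)"
  obtain m where m: "m holomorphic_on ?B"
    "\<And>u. u \<in> ?B - {0} \<Longrightarrow> twisted_zeta (pole 0 + u) = 1 / u + u * m u"
    using twisted_zeta_expansion_at_pole by blast
  define e where "e u = m u + u * deriv m u + 2 * m (- u) + u\<^sup>2 * (m (- u))\<^sup>2" for u
  have defect: "ode_defect (pole 0 + u) = e u" if u: "u \<in> ?B - {0}" for u
  proof -
    have u0: "u \<noteq> 0" using u by simp
    have mu: "(m has_field_derivative deriv m u) (at u)"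
      using holomorphic_derivI[OF m(1)] u by simp
    have "((\<lambda>u. 1 / u + u * m u) has_field_derivative (- 1 / u\<^sup>2 + (m u + u * deriv m u))) (at u)"
      using u0 by (auto intro!: derivative_eq_intros mu simp: power2_eq_square)
    then have "((\<lambda>u. twisted_zeta (pole 0 + u)) has_field_derivative (- 1 / u\<^sup>2 + (m u + u * deriv m u))) (at u)"
      by (rule has_field_derivative_transform_within_open[where S = "?B - {0}"])
         (use u m(2) in auto)
    moreover have "((\<lambda>u. twisted_zeta (pole 0 + u)) has_field_derivative deriv twisted_zeta (pole 0 + u)) (at u)"
      using twisted_zeta_has_field_derivative[OF pole_0_translate_notin_poles[OF u]]
      by (simp add: DERIV_shift add.commute)
    ultimately have d: "deriv twisted_zeta (pole 0 + u) = - 1 / u\<^sup>2 + (m u + u * deriv m u)"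
      by (metis DERIV_unique)
    have "chi (1, 1) = 1" using omega_cubed by (simp add: chi_def)
    moreover have "- pole 0 = pole 0 + lattice_point (1, 1)"
      using uminus_pole[of 0] pole_eq_translate[of "(1, 1)"] by simp
    then have "- (pole 0 + u) = (pole 0 + - u) + lattice_point (1, 1)" by simp
    then have "twisted_zeta (- (pole 0 + u)) = chi (1, 1) * twisted_zeta (pole 0 + - u)"
      by (simp only: twisted_zeta_translate)
    moreover have "twisted_zeta (pole 0 + - u) = - 1 / u - u * m (- u)"
      using m(2)[of "- u"] u by simp
    ultimately have g: "twisted_zeta (- (pole 0 + u)) = - (1 / u + u * m (- u))" by simp
    have "(twisted_zeta (- (pole 0 + u)))\<^sup>2 = 1 / u\<^sup>2 + 2 * m (- u) + u\<^sup>2 * (m (- u))\<^sup>2"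
      unfolding g using u0 by (simp add: field_simps eval_nat_numeral)
    then show ?thesis by (simp add: ode_defect_def d e_def)
  qed
  have "isCont m 0"
    using m(1) by (metis centre_in_ball continuous_on_interior holomorphic_on_imp_continuous_on
        interior_ball zero_less_divide_1_iff zero_less_numeral)
  moreover have "isCont (deriv m) 0"
    using holomorphic_deriv[OF m(1)] by (metis centre_in_ball continuous_on_interior holomorphic_on_imp_continuous_on
        interior_ball zero_less_divide_1_iff zero_less_numeral open_ball)
  moreover have "isCont (\<lambda>u. m (- u)) 0"
    using \<open>isCont m 0\<close> by (intro isCont_o2[of _ uminus m]) auto
  ultimately have "isCont e 0" unfolding e_def by (intro continuous_intros)
  then have lim: "(e \<longlongrightarrow> e 0) (at 0)" by (simp add: isCont_def)
  have "\<forall>\<^sub>F u in at 0. chi i * e u = ode_defect (pole i + u)"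
  proof -
    have "\<forall>\<^sub>F u in at (0::complex). u \<in> ball 0 (1 / 2) - {0}"
      by (rule eventually_at_in_open) auto
    then show ?thesis
    proof eventually_elim
      case (elim u)
      have "ode_defect (pole i + u) = ode_defect ((pole 0 + u) + lattice_point i)"
        by (simp add: pole_eq_translate[of i] add_ac)
      also have "\<dots> = chi i * e u"
        using ode_defect_translate[OF pole_0_translate_notin_poles[OF elim]] defect[OF elim] by simp
      finally show ?case by simp
    qed
  qed
  moreover have "((\<lambda>u. chi i * e u) \<longlongrightarrow> chi i * e 0) (at 0)"
    by (intro tendsto_intros lim)
  ultimately have "((\<lambda>u. ode_defect (pole i + u)) \<longlongrightarrow> chi i * e 0) (at 0)"
    by (rule Lim_transform_eventually[rotated])
  then have "(ode_defect \<longlongrightarrow> chi i * e 0) (at (pole i))"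
    using LIM_offset_zero_cancel[of ode_defect "pole i" "chi i * e 0"] by blast
  then show ?thesis by blast
qed

lemma lattice_covering: "\<exists>i. norm (z - lattice_point i) \<le> 2"
proof -
  define a b where "a = Re z / sqrt 3 + Im z" and "b = Re z / sqrt 3 - Im z"
  have z: "z = of_real a * \<xi> + of_real b * cnj \<xi>"
    by (simp add: complex_eq_iff \<xi>_def a_def b_def field_simps)
  have n: "norm \<xi> = 1" by (simp add: \<xi>_def cmod_def power2_eq_square)
  have "z - lattice_point (\<lfloor>a\<rfloor>, \<lfloor>b\<rfloor>) = of_real (frac a) * \<xi> + of_real (frac b) * cnj \<xi>"
    by (simp add: z lattice_point_def frac_def algebra_simps)
  also have "norm \<dots> \<le> \<bar>frac a\<bar> + \<bar>frac b\<bar>"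
    by (rule order_trans[OF norm_triangle_ineq]) (simp add: norm_mult n)
  also have "\<dots> \<le> 2" using frac_lt_1[of a] frac_lt_1[of b] by simp
  finally show ?thesis by blast
qed

text \<open>
Filling in the removable singularities gives an entire function. Its absolute value is
invariant under the lattice, so it is bounded, hence constant; the constant is multiplied by
\<omega>^2 under translation by \<xi>, so it is zero.
\<close>
theorem ode_defect_eq_0:
  assumes "z \<notin> range pole" shows "ode_defect z = 0"
proof -
  define H where "H = remove_sings ode_defect"
  have HE: "H z = ode_defect z" if "z \<notin> range pole" for z
  proof -
    have "ode_defect analytic_on {z}"
      using ode_defect_holomorphic open_regular that by (auto simp: analytic_at)
    then show ?thesis by (simp add: H_def)
  qed
  have "H analytic_on {z}" for z
  proof (cases "z \<in> range pole")
    case False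
    then have "ode_defect analytic_on {z}"
      using ode_defect_holomorphic open_regular by (auto simp: analytic_at)
    then show ?thesis unfolding H_def by (rule remove_sings_analytic_on)
  next
    case True
    then obtain i where i: "z = pole i" by auto
    obtain c where c: "(ode_defect \<longlongrightarrow> c) (at z)" using ode_defect_limit_at_pole i by blast
    have "ode_defect holomorphic_on ball z 1 - {z}"
    proof (rule holomorphic_on_subset[OF ode_defect_holomorphic], rule subsetI, rule ComplI)
      fix w assume w: "w \<in> ball z 1 - {z}" "w \<in> range pole"
      then obtain j where j: "w = pole j" by auto
      have "z - w = lattice_point (i - j)" by (simp add: i j pole_def lattice_point_diff)
      moreover from this have "i - j \<noteq> 0" using w lattice_point_0 by auto
      ultimately show False using w norm_lattice_point_ge_1[of "i - j"] by (simp add: dist_norm)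
    qed
    then have "isolated_singularity_at ode_defect z"
      by (intro isolated_singularity_at_holomorphic[of _ "ball z 1"]) auto
    then show ?thesis unfolding H_def using c by (rule remove_sings_analytic_at)
  qed
  then have H: "H holomorphic_on UNIV"
    by (metis analytic_imp_holomorphic analytic_on_analytic_at)
  then have Hcont: "continuous_on UNIV H" by (rule holomorphic_on_imp_continuous_on)
  have "bounded (H ` cball 0 2)"
    by (intro compact_imp_bounded compact_continuous_image continuous_on_subset[OF Hcont]) auto
  then obtain B where B: "\<And>z. norm z \<le> 2 \<Longrightarrow> norm (H z) \<le> B"
    unfolding bounded_iff by (metis imageI mem_cball_0)
  \<comment> \<open>The bound on a compact set is carried to all regular points by translation, and to the poles by density.\<close>
  have regular: "norm (H z) \<le> B" if z: "z \<notin> range pole" for z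
  proof -
    obtain i where i: "norm (z - lattice_point i) \<le> 2" using lattice_covering by blast
    have z': "z - lattice_point i \<notin> range pole"
      using translate_notin_poles[of "z - lattice_point i" i] z by simp
    have "ode_defect z = chi i * ode_defect (z - lattice_point i)" using ode_defect_translate[OF z', of i] by simp
    then have "norm (H z) = norm (H (z - lattice_point i))"
      using HE z z' by (simp add: norm_mult norm_chi)
    then show ?thesis using B i by simp
  qed
  have "norm (H z) \<le> B" for z
  proof -
    have "closed {z. norm (H z) \<le> B}"
      by (intro closed_Collect_le continuous_intros Hcont)
    moreover have "closure (- range pole) = UNIV"
    proof -
      have "interior (range pole) = {}"
      proof (rule ccontr)
        assume "interior (range pole) \<noteq> {}"
        then obtain z r where "r > 0" "ball z r \<subseteq> range pole"
          by (meson all_not_in_conv mem_interior)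
        then have "uncountable (ball z r)" "countable (ball z r)"
          using uncountable_ball[of r z] countable_subset[of "ball z r" "range pole"] by auto
        then show False by simp
      qed
      then show ?thesis by (simp add: closure_complement)
    qed
    ultimately show ?thesis using regular closure_minimal[of "- range pole" "{z. norm (H z) \<le> B}"] by auto
  qed
  then have "bounded (range H)" unfolding bounded_iff by auto
  then obtain c where c: "\<And>z. H z = c"
    using Liouville_theorem[OF H] unfolding constant_on_def by auto
  have 0: "0 \<notin> range pole" by (rule small_notin_poles) simp
  then have "lattice_point (1, 0) \<notin> range pole" using translate_notin_poles[of 0 "(1, 0)"] by simp
  then have "H (lattice_point (1, 0)) = chi (1, 0) * H 0" using ode_defect_translate[OF 0, of "(1, 0)"] HE 0 by simp
  then have "c = chi (1, 0) * c" by (simp only: c)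
  moreover have "chi (1, 0) \<noteq> 1"
    using omega_sum by (simp add: chi_def) (simp add: \<omega>_def complex_eq_iff)
  ultimately have "c = 0" by simp
  then show ?thesis using HE[OF assms] c by simp
qed

corollary twisted_zeta_ode:
  assumes "z \<notin> range pole"
  shows "(twisted_zeta has_field_derivative - (twisted_zeta (- z))\<^sup>2) (at z)"
proof -
  have "deriv twisted_zeta z = - (twisted_zeta (- z))\<^sup>2" using ode_defect_eq_0[OF assms] by (simp add: ode_defect_def add_eq_0_iff2)
  then show ?thesis using twisted_zeta_has_field_derivative[OF assms] by simp
qed

section \<open>Taylor coefficients as lattice sums\<close>

text \<open>
All poles have absolute value at least 1/2, so higher exponents reduce to the exponent 3.
\<close>
lemma summable_character_sum:
  assumes "n \<ge> 2"
  shows "(\<lambda>i. chi i / pole i ^ (n + 1)) summable_on UNIV"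
proof (rule abs_summable_summable, rule summable_on_comparison_test)
  show "(\<lambda>i. 2 ^ (n - 2) * (1 / norm (pole i) ^ 3)) summable_on UNIV"
    by (intro summable_on_cmult_right summable_inverse_norm_cubed_pole)
  show "norm (chi i / pole i ^ (n + 1)) \<le> 2 ^ (n - 2) * (1 / norm (pole i) ^ 3)" for i
  proof -
    define x where "x = norm (pole i)"
    have x: "x \<ge> 1 / 2" using norm_pole_ge_half x_def by simp
    have "norm (chi i / pole i ^ (n + 1)) = (1 / x) ^ (n - 2 + 3)"
      using assms by (simp add: norm_divide norm_chi norm_mult norm_power x_def power_one_over)
    also have "\<dots> = (1 / x) ^ (n - 2) * (1 / x ^ 3)"
      by (simp add: power_add power_one_over)
    also have "1 / x \<le> 2" using x by (simp add: field_simps)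
    then have "(1 / x) ^ (n - 2) \<le> 2 ^ (n - 2)" using x by (intro power_mono) auto
    then have "(1 / x) ^ (n - 2) * (1 / x ^ 3) \<le> 2 ^ (n - 2) * (1 / x ^ 3)"
      using x by (intro mult_right_mono) auto
    finally show ?thesis by (simp add: x_def)
  qed
qed auto

lemma higher_deriv_sum:
  assumes "finite A" "\<And>j. j \<in> A \<Longrightarrow> f j holomorphic_on S" "open S" "z \<in> S"
  shows "(deriv ^^ n) (\<lambda>w. \<Sum>j\<in>A. f j w) z = (\<Sum>j\<in>A. (deriv ^^ n) (f j) z)"
  using assms(1,2)
proof (induction A rule: finite_induct)
  case empty
  show ?case by simp
next
  case (insert j A)
  have "(deriv ^^ n) (\<lambda>w. f j w + (\<Sum>j\<in>A. f j w)) z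
      = (deriv ^^ n) (f j) z + (deriv ^^ n) (\<lambda>w. \<Sum>j\<in>A. f j w) z"
    by (rule higher_deriv_add[OF _ _ assms(3,4)]) (use insert in \<open>auto intro!: holomorphic_on_sum\<close>)
  then show ?case using insert by simp
qed

lemma has_sum_sum_finite:
  fixes f :: "'a \<Rightarrow> 'b \<Rightarrow> complex"
  assumes "finite A" "\<And>j. j \<in> A \<Longrightarrow> (f j has_sum s j) I"
  shows "((\<lambda>i. \<Sum>j\<in>A. f j i) has_sum (\<Sum>j\<in>A. s j)) I"
  using assms
  by (induction A rule: finite_induct) (auto intro!: has_sum_0 has_sum_add)

lemma higher_deriv_inverse_translate:
  fixes z q :: complex
  assumes "z \<noteq> q"
  shows "(deriv ^^ n) (\<lambda>z. inverse (z - q)) z = (- 1) ^ n * fact n / (z - q) ^ (n + 1)"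
  using assms
proof (induction n arbitrary: z)
  case 0
  then show ?case by (simp add: inverse_eq_divide)
next
  case (Suc n)
  have "((\<lambda>z. (- 1) ^ n * fact n / (z - q) ^ (n + 1)) has_field_derivative
      (- 1) ^ Suc n * fact (Suc n) / (z - q) ^ (Suc n + 1)) (at z)"
  proof -
    define w where "w = z - q"
    have w: "w \<noteq> 0" using Suc.prems by (simp add: w_def)
    have d: "((\<lambda>z. (z - q) ^ (n + 1)) has_field_derivative of_nat (n + 1) * w ^ n) (at z)"
      unfolding w_def by (rule derivative_eq_intros refl)+ simp
    have "((\<lambda>z. (- 1) ^ n * fact n * inverse ((z - q) ^ (n + 1))) has_field_derivative
        (- 1) ^ n * fact n * - (of_nat (n + 1) * w ^ n * inverse ((w ^ (n + 1)) ^ Suc (Suc 0)))) (at z)"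
      using DERIV_cmult[OF DERIV_inverse_fun[OF d], of "(- 1) ^ n * fact n"] w by (simp only: w_def) simp
    moreover have "(- 1) ^ n * fact n * - (of_nat (n + 1) * w ^ n * inverse ((w ^ (n + 1)) ^ Suc (Suc 0)))
        = (- 1) ^ Suc n * fact (Suc n) / w ^ (Suc n + 1)"
      using w by (simp add: field_simps)
    ultimately show ?thesis by (simp only: divide_inverse w_def)
  qed
  then have "((deriv ^^ n) (\<lambda>z. inverse (z - q)) has_field_derivative
      (- 1) ^ Suc n * fact (Suc n) / (z - q) ^ (Suc n + 1)) (at z)"
    by (rule has_field_derivative_transform_within_open[where S = "- {q}"])
       (use Suc in auto)
  then show ?case by (simp add: DERIV_imp_deriv)
qed

lemma higher_deriv_zeta_kernel:
  "(deriv ^^ n) (\<lambda>z. zeta_kernel (z - pole i)) 0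
     = - fact n * (1 / pole i ^ (n + 1) - 1 / 6 * (\<Sum>j\<in>unit_indices. 1 / pole (i + j) ^ (n + 1)))"
proof -
  let ?B = "ball (0::complex) (1 / 2)"
  have away: "z \<noteq> pole i" if "z \<in> ?B" for z i
    using that small_notin_poles[of z] by auto
  have nz: "pole i \<noteq> 0" for i using away[of 0 i] by auto
  have hol: "(\<lambda>z. inverse (z - pole i)) holomorphic_on ?B" for i
    using away by (intro holomorphic_intros) auto
  have base: "(deriv ^^ n) (\<lambda>z. inverse (z - pole i)) 0 = - fact n * (1 / pole i ^ (n + 1))" for i
  proof -
    have "(- pole i) ^ (n + 1) = (- 1) ^ n * (- (pole i ^ (n + 1)))"
      by (subst power_minus) simp
    then show ?thesis
      using higher_deriv_inverse_translate[of 0 "pole i" n] nz by (simp add: field_simps)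
  qed
  have eq: "zeta_kernel (z - pole i) = inverse (z - pole i) - 1 / 6 * (\<Sum>j\<in>unit_indices. inverse (z - pole (i + j)))"
    if "z \<in> ?B" for z
  proof -
    have "z - pole i \<noteq> lattice_point j" for j
      using away[OF that, of "i + j"] by (auto simp: pole_add algebra_simps)
    then have "zeta_kernel (z - pole i) = 1 / (z - pole i) - 1 / 6 * (\<Sum>j\<in>unit_indices. 1 / (z - pole i - lattice_point j))"
      by (intro zeta_kernel_partial_fractions)
    then show ?thesis by (simp add: inverse_eq_divide pole_add diff_diff_eq)
  qed
  have sumhol: "(\<lambda>z. \<Sum>j\<in>unit_indices. inverse (z - pole (i + j))) holomorphic_on ?B"
    by (intro holomorphic_on_sum hol)
  have sumd: "(deriv ^^ n) (\<lambda>z. \<Sum>j\<in>unit_indices. inverse (z - pole (i + j))) 0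
        = - fact n * (\<Sum>j\<in>unit_indices. 1 / pole (i + j) ^ (n + 1))"
    by (subst higher_deriv_sum[OF finite_unit_indices hol]) (simp_all add: base sum_distrib_left sum_negf)
  have "(deriv ^^ n) (\<lambda>z. zeta_kernel (z - pole i)) 0 =
      (deriv ^^ n) (\<lambda>z. inverse (z - pole i) - 1 / 6 * (\<Sum>j\<in>unit_indices. inverse (z - pole (i + j)))) 0"
  proof (rule higher_deriv_cong_ev)
    have "\<forall>\<^sub>F z in nhds 0. z \<in> ?B" by (rule eventually_nhds_in_open) auto
    then show "\<forall>\<^sub>F z in nhds 0. zeta_kernel (z - pole i)
        = inverse (z - pole i) - 1 / 6 * (\<Sum>j\<in>unit_indices. inverse (z - pole (i + j)))"
      by eventually_elim (rule eq)
  qed simp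
  also have "\<dots> = (deriv ^^ n) (\<lambda>z. inverse (z - pole i)) 0
       - (deriv ^^ n) (\<lambda>z. 1 / 6 * (\<Sum>j\<in>unit_indices. inverse (z - pole (i + j)))) 0"
    by (rule higher_deriv_diff[of _ ?B])
       (use hol sumhol in \<open>auto intro!: holomorphic_on_divide\<close>)
  also have "(deriv ^^ n) (\<lambda>z. 1 / 6 * (\<Sum>j\<in>unit_indices. inverse (z - pole (i + j)))) 0
       = 1 / 6 * (deriv ^^ n) (\<lambda>z. \<Sum>j\<in>unit_indices. inverse (z - pole (i + j))) 0"
    by (rule higher_deriv_cmult[of _ ?B]) (auto intro!: sumhol)
  finally show ?thesis
    unfolding base sumd by (simp only: right_diff_distrib mult.left_commute)
qed

text \<open>
Locally uniform convergence permits termwise differentiation. The partial fractions of the kernel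
then produce the lattice sum and six translates of it; for exponents at least 3 each of
these converges by itself, and the factor 3/2 that was put into the definition of the function
comes out again.
\<close>
theorem higher_deriv_twisted_zeta:
  assumes "n \<ge> 2"
  shows "(deriv ^^ n) twisted_zeta 0 = - fact n * (\<Sum>\<^sub>\<infinity>i. chi i / pole i ^ (n + 1))"
proof -
  let ?B = "ball (0::complex) (1 / 4)"
  let ?c = "\<lambda>i. chi i / pole i ^ (n + 1)"
  define T where "T = (\<Sum>\<^sub>\<infinity>i. ?c i)"
  define G where "G z = (\<Sum>\<^sub>\<infinity>i. chi i * zeta_kernel (z - pole i))" for z
  have away: "1 / 4 \<le> norm (z - pole i - lattice_point j)" if "z \<in> ?B" for z i j
  proof -
    have "norm (pole (i + j)) \<ge> 1 / 2" by (rule norm_pole_ge_half)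
    moreover have "norm (z - pole i - lattice_point j) = norm (pole (i + j) - z)"
      by (simp add: pole_add norm_minus_commute diff_diff_eq)
    ultimately show ?thesis
      using that norm_triangle_ineq2[of "pole (i + j)" z] by simp
  qed
  have D: "norm z \<le> 1" if "z \<in> ?B" for z using that by simp
  have term_hol: "(\<lambda>z. zeta_kernel (z - pole i)) holomorphic_on ?B" for i
  proof -
    have "(\<lambda>z. chi i * zeta_kernel (z - pole i)) holomorphic_on ?B"
      by (rule holomorphic_summand[of "1 / 4" 1 _ UNIV]) (use away D in auto)
    then have "(\<lambda>z. inverse (chi i) * (chi i * zeta_kernel (z - pole i))) holomorphic_on ?B"
      by (rule holomorphic_on_mult[OF holomorphic_on_const])
    moreover have "inverse (chi i) * (chi i * x) = x" for x using chi_nonzero[of i] by simp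
    ultimately show ?thesis by (simp only:)
  qed
  have finsum: "(deriv ^^ n) (\<lambda>z. \<Sum>i\<in>X. chi i * zeta_kernel (z - pole i)) 0
        = (\<Sum>i\<in>X. chi i * (deriv ^^ n) (\<lambda>z. zeta_kernel (z - pole i)) 0)" if "finite X" for X
  proof -
    have "(deriv ^^ n) (\<lambda>z. \<Sum>i\<in>X. chi i * zeta_kernel (z - pole i)) 0
        = (\<Sum>i\<in>X. (deriv ^^ n) (\<lambda>z. chi i * zeta_kernel (z - pole i)) 0)"
      by (rule higher_deriv_sum[OF that, of _ ?B]) (auto intro!: term_hol holomorphic_on_mult)
    also have "\<dots> = (\<Sum>i\<in>X. chi i * (deriv ^^ n) (\<lambda>z. zeta_kernel (z - pole i)) 0)"
      by (intro sum.cong refl higher_deriv_cmult[of _ ?B]) (auto intro!: term_hol)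
    finally show ?thesis .
  qed
  have "((\<lambda>X. (deriv ^^ n) (\<lambda>z. \<Sum>i\<in>X. chi i * zeta_kernel (z - pole i)) 0) \<longlongrightarrow> (deriv ^^ n) G 0)
      (finite_subsets_at_top UNIV)"
    unfolding G_def
  proof (rule higher_deriv_complex_uniform_limit)
    show "uniform_limit ?B (\<lambda>X z. \<Sum>i\<in>X. chi i * zeta_kernel (z - pole i))
        (\<lambda>z. \<Sum>\<^sub>\<infinity>i. chi i * zeta_kernel (z - pole i)) (finite_subsets_at_top UNIV)"
      by (rule uniform_limit_summands[of "1 / 4" 1]) (use away D in auto)
    show "\<forall>\<^sub>F X in finite_subsets_at_top UNIV. (\<lambda>z. \<Sum>i\<in>X. chi i * zeta_kernel (z - pole i)) holomorphic_on ?B"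
      by (rule holomorphic_finite_sum[of "1 / 4" 1]) (use away D in auto)
  qed auto
  then have "((\<lambda>X. \<Sum>i\<in>X. chi i * (deriv ^^ n) (\<lambda>z. zeta_kernel (z - pole i)) 0) \<longlongrightarrow> (deriv ^^ n) G 0)
      (finite_subsets_at_top UNIV)"
    by (rule Lim_transform_eventually)
       (auto intro!: eventually_finite_subsets_at_top_weakI finsum)
  then have G: "((\<lambda>i. chi i * (deriv ^^ n) (\<lambda>z. zeta_kernel (z - pole i)) 0) has_sum (deriv ^^ n) G 0) UNIV"
    unfolding has_sum_def .
  have c: "(?c has_sum T) UNIV"
    unfolding T_def by (intro has_sum_infsum summable_character_sum assms)
  have shifted: "((\<lambda>i. chi i / pole (i + j) ^ (n + 1)) has_sum chi (- j) * T) UNIV" for j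
  proof -
    have bij: "bij_betw (\<lambda>i. i + j) UNIV UNIV"
      by (rule bij_betwI[where g = "\<lambda>i. i - j"]) auto
    have "((\<lambda>i. ?c (i + j)) has_sum T) UNIV"
      using c has_sum_reindex_bij_betw[OF bij, of ?c T] by simp
    then have "((\<lambda>i. chi (- j) * ?c (i + j)) has_sum chi (- j) * T) UNIV"
      by (rule has_sum_cmult_right)
    moreover have "chi (- j) * ?c (i + j) = chi i / pole (i + j) ^ (n + 1)" for i
      using chi_nonzero[of j] by (simp add: chi_add chi_minus)
    ultimately show ?thesis by (simp only:)
  qed
  have "((\<lambda>i. - fact n * (?c i + (- 1 / 6) * (\<Sum>j\<in>unit_indices. chi i / pole (i + j) ^ (n + 1)))) has_sum
      - fact n * (T + (- 1 / 6) * (\<Sum>j\<in>unit_indices. chi (- j) * T))) UNIV"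
    by (intro has_sum_cmult_right has_sum_add c has_sum_sum_finite finite_unit_indices shifted)
  moreover have "chi i * (deriv ^^ n) (\<lambda>z. zeta_kernel (z - pole i)) 0
      = - fact n * (?c i + (- 1 / 6) * (\<Sum>j\<in>unit_indices. chi i / pole (i + j) ^ (n + 1)))" for i
  proof -
    have "(\<Sum>j\<in>unit_indices. chi i / pole (i + j) ^ (n + 1)) = chi i * (\<Sum>j\<in>unit_indices. 1 / pole (i + j) ^ (n + 1))"
      by (simp add: sum_distrib_left)
    then show ?thesis unfolding higher_deriv_zeta_kernel by (simp only:) (simp add: algebra_simps)
  qed
  ultimately have "(deriv ^^ n) G 0 = - fact n * (T + (- 1 / 6) * (\<Sum>j\<in>unit_indices. chi (- j) * T))"
    using G has_sum_unique by (simp only:) blast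
  also have "(\<Sum>j\<in>unit_indices. chi (- j) * T) = (\<Sum>j\<in>unit_indices. chi j) * T"
  proof -
    have "bij_betw uminus unit_indices unit_indices"
      by (rule bij_betwI[where g = uminus]) (auto simp: unit_indices_def)
    then have "(\<Sum>j\<in>unit_indices. chi (- j)) = (\<Sum>j\<in>unit_indices. chi j)" by (rule sum.reindex_bij_betw)
    then show ?thesis by (simp add: sum_distrib_right[symmetric])
  qed
  finally have "(deriv ^^ n) G 0 = - fact n * (3 / 2 * T)"
    unfolding sum_chi_unit_indices by (simp add: algebra_simps)
  moreover have "(deriv ^^ n) twisted_zeta 0 = 2 / 3 * (deriv ^^ n) G 0"
  proof -
    have "G holomorphic_on ?B" unfolding G_def
      by (rule holomorphic_infinite_sum[of "1 / 4" 1]) (use away D in auto)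
    then have "(deriv ^^ n) (\<lambda>z. 2 / 3 * G z) 0 = 2 / 3 * (deriv ^^ n) G 0"
      by (intro higher_deriv_cmult[of _ ?B]) auto
    then show ?thesis by (simp add: twisted_zeta_def[abs_def] G_def)
  qed
  ultimately show ?thesis by (simp add: T_def)
qed

section \<open>Taylor coefficients as pseudo-factorials\<close>

lemma twisted_zeta_holomorphic_half_ball: "twisted_zeta holomorphic_on ball 0 (1 / 2)"
  by (rule holomorphic_on_subset[OF twisted_zeta_holomorphic], rule subsetI, rule ComplI)
     (metis small_notin_poles mem_ball_0)

text \<open>
Leibniz' rule applied to the differential equation; the reflection z \<mapsto> -z supplies the signs
(-1)^k and (-1)^(n-k), whose product does not depend on k.
\<close>
lemma higher_deriv_twisted_zeta_Suc:
  "(deriv ^^ Suc n) twisted_zeta 0 =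
     (- 1) ^ (n + 1) * (\<Sum>k = 0..n. of_nat (n choose k) * (deriv ^^ k) twisted_zeta 0 * (deriv ^^ (n - k)) twisted_zeta 0)"
proof -
  let ?B = "ball (0::complex) (1 / 2)"
  define G where "G z = twisted_zeta (- 1 * z)" for z
  have "twisted_zeta \<circ> (\<lambda>z. - 1 * z) holomorphic_on ?B"
    by (rule holomorphic_on_compose_gen[OF _ twisted_zeta_holomorphic_half_ball]) (auto intro!: holomorphic_intros)
  then have G: "G holomorphic_on ?B" by (simp add: G_def[abs_def] o_def)
  have dG: "(deriv ^^ k) G 0 = (- 1) ^ k * (deriv ^^ k) twisted_zeta 0" for k
    using higher_deriv_compose_linear[OF twisted_zeta_holomorphic_half_ball, of ?B 0 "- 1" k]
    by (simp add: G_def[abs_def])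
  have "(deriv ^^ Suc n) twisted_zeta 0 = (deriv ^^ n) (deriv twisted_zeta) 0"
    by (simp only: funpow_Suc_right o_apply)
  also have "\<dots> = (deriv ^^ n) (\<lambda>z. - 1 * (G z * G z)) 0"
  proof (rule higher_deriv_transform_within_open)
    show "deriv twisted_zeta holomorphic_on ?B"
      by (intro holomorphic_deriv twisted_zeta_holomorphic_half_ball) simp
    show "(\<lambda>z. - 1 * (G z * G z)) holomorphic_on ?B"
      by (intro holomorphic_on_mult G holomorphic_on_const)
    show "deriv twisted_zeta z = - 1 * (G z * G z)" if "z \<in> ?B" for z
    proof -
      have "z \<notin> range pole" by (rule small_notin_poles) (use that in simp)
      from DERIV_imp_deriv[OF twisted_zeta_ode[OF this]] show ?thesis by (simp add: G_def power2_eq_square)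
    qed
  qed auto
  also have "\<dots> = - 1 * (deriv ^^ n) (\<lambda>z. G z * G z) 0"
    by (rule higher_deriv_cmult[of _ ?B]) (auto intro!: holomorphic_on_mult G)
  also have "(deriv ^^ n) (\<lambda>z. G z * G z) 0 =
      (\<Sum>k = 0..n. of_nat (n choose k) * (deriv ^^ k) G 0 * (deriv ^^ (n - k)) G 0)"
    by (rule higher_deriv_mult[OF G G]) auto
  also have "\<dots> = (\<Sum>k = 0..n. (- 1) ^ n * (of_nat (n choose k) * (deriv ^^ k) twisted_zeta 0 * (deriv ^^ (n - k)) twisted_zeta 0))"
  proof (rule sum.cong)
    fix k assume "k \<in> {0..n}"
    then have "(- 1 :: complex) ^ n = (- 1) ^ k * (- 1) ^ (n - k)" by (simp add: power_add[symmetric])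
    then show "of_nat (n choose k) * (deriv ^^ k) G 0 * (deriv ^^ (n - k)) G 0 =
        (- 1) ^ n * (of_nat (n choose k) * (deriv ^^ k) twisted_zeta 0 * (deriv ^^ (n - k)) twisted_zeta 0)"
      by (simp add: dG mult_ac)
  qed simp
  also have "\<dots> = (- 1) ^ n * (\<Sum>k = 0..n. of_nat (n choose k) * (deriv ^^ k) twisted_zeta 0 * (deriv ^^ (n - k)) twisted_zeta 0)"
    by (rule sum_distrib_left[symmetric])
  finally show ?thesis by simp
qed

text \<open>
The derivatives obey the recurrence of the pseudo-factorials, which is homogeneous: the initial
value A in place of 1 leads to the factor A^(n+1).
\<close>
theorem higher_deriv_twisted_zeta_pseudo_factorial:
  "(deriv ^^ n) twisted_zeta 0 = twisted_zeta 0 ^ (n + 1) * of_int (pseudo_factorial n)"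
proof (induction n rule: less_induct)
  case (less n)
  show ?case
  proof (cases n)
    case 0
    then show ?thesis by simp
  next
    case (Suc m)
    have "(\<Sum>k = 0..m. of_nat (m choose k) * (deriv ^^ k) twisted_zeta 0 * (deriv ^^ (m - k)) twisted_zeta 0)
        = (\<Sum>k = 0..m. twisted_zeta 0 ^ (m + 2) * of_int (int (m choose k) * pseudo_factorial k * pseudo_factorial (m - k)))"
    proof (rule sum.cong)
      fix k assume k: "k \<in> {0..m}"
      then have pow: "twisted_zeta 0 ^ (m + 2) = twisted_zeta 0 ^ (k + 1) * twisted_zeta 0 ^ (m - k + 1)" by (simp add: power_add[symmetric])
      have IH: "(deriv ^^ k) twisted_zeta 0 = twisted_zeta 0 ^ (k + 1) * of_int (pseudo_factorial k)"
        "(deriv ^^ (m - k)) twisted_zeta 0 = twisted_zeta 0 ^ (m - k + 1) * of_int (pseudo_factorial (m - k))"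
        using k Suc by (auto intro!: less.IH simp only: atLeastAtMost_iff)
      show "of_nat (m choose k) * (deriv ^^ k) twisted_zeta 0 * (deriv ^^ (m - k)) twisted_zeta 0
        = twisted_zeta 0 ^ (m + 2) * of_int (int (m choose k) * pseudo_factorial k * pseudo_factorial (m - k))"
        unfolding IH pow by (simp only: of_int_mult of_int_of_nat_eq mult_ac)
    qed simp
    also have "\<dots> = twisted_zeta 0 ^ (m + 2) *
        of_int (\<Sum>k = 0..m. int (m choose k) * pseudo_factorial k * pseudo_factorial (m - k))"
      by (simp only: of_int_sum sum_distrib_left)
    finally show ?thesis unfolding Suc higher_deriv_twisted_zeta_Suc by (simp add: mult_ac)
  qed
qed

section \<open>The function on the real axis\<close>

definition real_zeta :: "real \<Rightarrow> real" where
  "real_zeta x = Re (twisted_zeta (of_real x))"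

lemma twisted_zeta_of_real: "twisted_zeta (of_real x) = of_real (real_zeta x)"
  using twisted_zeta_cnj[of "of_real x"] by (simp add: real_zeta_def complex_eq_iff)

lemma real_zeta_ode:
  assumes "\<bar>x\<bar> < 1 / 2"
  shows "(real_zeta has_real_derivative - (real_zeta (- x))\<^sup>2) (at x)"
proof -
  have "complex_of_real x \<notin> range pole" by (rule small_notin_poles) (use assms in simp)
  from twisted_zeta_ode[OF this]
  have "(twisted_zeta has_field_derivative of_real (- (real_zeta (- x))\<^sup>2)) (at (of_real x))"
    using twisted_zeta_of_real[of "- x"] by simp
  then have "((\<lambda>x. twisted_zeta (of_real x)) has_vector_derivative of_real (- (real_zeta (- x))\<^sup>2)) (at x)"
    by (rule has_vector_derivative_real_field)
  then have "((\<lambda>x. Re (twisted_zeta (of_real x))) has_vector_derivative Re (of_real (- (real_zeta (- x))\<^sup>2))) (at x)"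
    by (rule bounded_linear.has_vector_derivative[OF bounded_linear_Re])
  then show ?thesis
    by (simp only: real_zeta_def[abs_def] has_real_derivative_iff_has_vector_derivative Re_complex_of_real)
qed

lemma real_zeta_reflected_ode:
  assumes "\<bar>x\<bar> < 1 / 2"
  shows "((\<lambda>x. real_zeta (- x)) has_real_derivative (real_zeta x)\<^sup>2) (at x)"
proof -
  have "(real_zeta has_real_derivative - (real_zeta x)\<^sup>2) (at (- x))" using real_zeta_ode[of "- x"] assms by simp
  moreover have "(uminus has_real_derivative - 1) (at x)" by (auto intro!: derivative_eq_intros)
  ultimately have "((\<lambda>x. real_zeta (- x)) has_real_derivative - (real_zeta x)\<^sup>2 * - 1) (at x)"
    by (rule DERIV_chain2[where f = real_zeta and g = uminus])
  then show ?thesis by simp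
qed

text \<open>
x^3 + y^3 is a first integral of the system x' = - y^2, y' = x^2, which Z(t) and Z(-t) solve.
\<close>
lemma real_zeta_fermat_cubic:
  assumes "\<bar>x\<bar> < 1 / 2"
  shows "real_zeta x ^ 3 + real_zeta (- x) ^ 3 = 2 * real_zeta 0 ^ 3"
proof -
  let ?h = "\<lambda>x. real_zeta x ^ 3 + real_zeta (- x) ^ 3"
  have "\<exists>c. \<forall>x\<in>{- 1 / 2 <..< 1 / 2}. ?h x = c"
  proof (rule has_field_derivative_zero_constant)
    fix x :: real assume "x \<in> {- 1 / 2 <..< 1 / 2}"
    then have x: "\<bar>x\<bar> < 1 / 2" by auto
    have "(?h has_real_derivative 0) (at x)"
      by (rule derivative_eq_intros real_zeta_ode real_zeta_reflected_ode x refl)+ (simp add: algebra_simps)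
    then show "(?h has_real_derivative 0) (at x within {- 1 / 2 <..< 1 / 2})"
      by (rule has_field_derivative_at_within)
  qed simp
  then obtain c where c: "\<forall>x\<in>{- 1 / 2 <..< 1 / 2}. ?h x = c" by blast
  have "?h x = c" by (rule bspec[OF c]) (use assms in auto)
  moreover have "?h 0 = c" by (rule bspec[OF c]) auto
  ultimately show ?thesis by simp
qed

text \<open>
Measured from the pole - sqrt 3 / 2 this is the point 2 / sqrt 3, twice the centroid of a
fundamental triangle, and one of the fixed points of the rotation modulo the lattice.
\<close>
definition zero_abscissa :: real where "zero_abscissa = sqrt 3 / 6"

lemma zero_abscissa_bounds: "0 < zero_abscissa" "zero_abscissa < 1 / 2"
  using real_sqrt_less_mono[of 3 9] by (simp_all add: zero_abscissa_def)

text \<open>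
Rotation about the pole of index 0 moves the point by a lattice vector. The rotation multiplies the
value by \<omega>^2, the translation by \<omega>; so the value is zero.
\<close>
lemma real_zeta_zero_abscissa: "real_zeta zero_abscissa = 0"
proof -
  define u where "u = complex_of_real (2 / sqrt 3)"
  have s: "sqrt 3 * sqrt 3 = (3::real)" by simp
  have "pole 0 + u = of_real zero_abscissa"
    using s by (simp add: pole_def lattice_point_0 u_def zero_abscissa_def complex_eq_iff field_simps)
  moreover have "pole 0 + \<omega> * u = of_real zero_abscissa + lattice_point (0, - 2)"
    using s by (simp add: pole_def lattice_point_0 lattice_point_def \<xi>_def \<omega>_def u_def zero_abscissa_def complex_eq_iff field_simps)
  ultimately have "chi (0, - 2) * twisted_zeta (of_real zero_abscissa) = \<omega>\<^sup>2 * twisted_zeta (of_real zero_abscissa)"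
    using twisted_zeta_rotate[of u] twisted_zeta_translate[of "of_real zero_abscissa" "(0, - 2)"] by simp
  moreover have "chi (0, - 2) = \<omega>"
    using omega_cubed inverse_omega
    by (simp add: chi_def power_int_minus power_inverse[symmetric] eval_nat_numeral)
  moreover have "\<omega> \<noteq> \<omega>\<^sup>2" using omega_nonzero omega_neq_1 by (simp add: power2_eq_square)
  ultimately have "twisted_zeta (of_real zero_abscissa) = 0" by simp
  then show ?thesis by (simp add: real_zeta_def)
qed

text \<open>
Otherwise all derivatives at 0 vanish, and the function is zero on the ball of radius 1/2. But the
pole i/2 lies on the boundary of this ball, and its residue is not zero.
\<close>
lemma twisted_zeta_0_nonzero: "twisted_zeta 0 \<noteq> 0"
proof
  assume "twisted_zeta 0 = 0"
  then have "(deriv ^^ n) twisted_zeta 0 = 0" for n unfolding higher_deriv_twisted_zeta_pseudo_factorial by simp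
  then have zero: "twisted_zeta w = 0" if "w \<in> ball 0 (1 / 2)" for w
    using holomorphic_fun_eq_0_on_ball[OF twisted_zeta_holomorphic_half_ball that] by blast
  define p where "p = pole (1, 0)"
  have "p = \<i> / 2" by (simp add: p_def pole_def lattice_point_def \<xi>_def complex_eq_iff)
  then have "norm p = norm (\<i> / 2)" by (simp only:)
  then have "norm p = 1 / 2" by (simp add: norm_divide)
  then have p: "p islimpt ball 0 (1 / 2)" by (simp add: islimpt_ball)
  \<comment> \<open>The residue at p is a limit along the ball as well, where the function is zero.\<close>
  have "((\<lambda>u. chi (1, 0) * (u * twisted_zeta (pole 0 + u))) \<longlongrightarrow> chi (1, 0) * 1) (at 0)"
    by (intro tendsto_mult_left twisted_zeta_residue)
  moreover have "chi (1, 0) * (u * twisted_zeta (pole 0 + u)) = u * twisted_zeta (p + u)" for u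
    using twisted_zeta_translate[of "pole 0 + u" "(1, 0)"] by (simp add: p_def pole_eq_translate[of "(1, 0)"] add_ac)
  ultimately have "((\<lambda>u. u * twisted_zeta (p + u)) \<longlongrightarrow> chi (1, 0)) (at 0)" by simp
  then have "((\<lambda>z. (z - p) * twisted_zeta z) \<longlongrightarrow> chi (1, 0)) (at p)"
    using LIM_offset_zero_cancel[of "\<lambda>z. (z - p) * twisted_zeta z" p "chi (1, 0)"] by simp
  then have "((\<lambda>z. (z - p) * twisted_zeta z) \<longlongrightarrow> chi (1, 0)) (at p within ball 0 (1 / 2))"
    by (rule tendsto_within_subset) simp
  moreover have "((\<lambda>z. (z - p) * twisted_zeta z) \<longlongrightarrow> 0) (at p within ball 0 (1 / 2))"
    by (rule tendsto_eventually) (auto simp: eventually_at_filter zero)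
  ultimately have "chi (1, 0) = 0"
    using p tendsto_unique trivial_limit_within by blast
  then show False using chi_nonzero by blast
qed

lemma real_zeta_antimono:
  assumes "- (1 / 2) < x" "x \<le> y" "y < 1 / 2"
  shows "real_zeta y \<le> real_zeta x"
proof (rule DERIV_nonpos_imp_nonincreasing[OF assms(2)])
  fix t assume "x \<le> t" "t \<le> y"
  then have "\<bar>t\<bar> < 1 / 2" using assms by auto
  then show "\<exists>d. (real_zeta has_real_derivative d) (at t) \<and> d \<le> 0"
    using real_zeta_ode by (intro exI[of _ "- (real_zeta (- t))\<^sup>2"]) auto
qed

lemma real_zeta_0_pos: "real_zeta 0 > 0"
proof -
  have "real_zeta 0 \<ge> 0" using real_zeta_antimono[of 0 zero_abscissa] real_zeta_zero_abscissa zero_abscissa_bounds by simp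
  moreover have "real_zeta 0 \<noteq> 0" using twisted_zeta_0_nonzero twisted_zeta_of_real[of 0] by simp
  ultimately show ?thesis by simp
qed

text \<open>
Left of 0 monotonicity suffices. Right of 0 the slope - Z(-x)^2 is at most - Z(0)^2 < 0, so the
function decreases strictly to its zero.
\<close>
lemma real_zeta_pos:
  assumes "- zero_abscissa \<le> x" "x < zero_abscissa" shows "real_zeta x > 0"
proof (cases "x \<le> 0")
  case True
  then have "real_zeta 0 \<le> real_zeta x" using assms zero_abscissa_bounds by (intro real_zeta_antimono) auto
  then show ?thesis using real_zeta_0_pos by simp
next
  case False
  have "real_zeta zero_abscissa < real_zeta x"
  proof (rule DERIV_neg_imp_decreasing[OF assms(2)])
    fix t assume t: "x \<le> t" "t \<le> zero_abscissa"
    then have "real_zeta 0 \<le> real_zeta (- t)" using False zero_abscissa_bounds by (intro real_zeta_antimono) auto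
    then have "real_zeta (- t) > 0" using real_zeta_0_pos by simp
    then show "\<exists>d. (real_zeta has_real_derivative d) (at t) \<and> d < 0"
      using real_zeta_ode[of t] t False zero_abscissa_bounds by (intro exI[of _ "- (real_zeta (- t))\<^sup>2"]) auto
  qed
  then show ?thesis by (simp add: real_zeta_zero_abscissa)
qed

section \<open>The value at the origin\<close>

text \<open>
Substitute t = Z(x)^3 / (2 Z(0)^3) in the Beta integral, for x between the zero of Z and its
negative; by the first integral 1 - t is the same expression in Z(-x). As the integrand is
unbounded at both ends, the substitution is carried out on the primitive \<Phi>, which is continuous on
the closed interval: \<Phi> \<circ> t has constant derivative in the interior.
\<close>
theorem Beta_third: "Beta (1 / 3) (1 / 3 :: real) = sqrt 3 * 2 powr (1 / 3) * real_zeta 0"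
proof -
  define D where "D = 2 * real_zeta 0 ^ 3"
  have D: "D > 0" using real_zeta_0_pos by (simp add: D_def)
  define g where "g t = t powr (- 2 / 3) * (1 - t) powr (- 2 / 3)" for t :: real
  have g: "(g has_integral Beta (1 / 3) (1 / 3)) {0..1}"
    using has_integral_Beta_real[of "1 / 3" "1 / 3"] by (simp add: g_def[abs_def])
  then have g_int: "g integrable_on {0..1}" by blast
  define \<Phi> where "\<Phi> s = integral {0..s} g" for s
  have \<Phi>_cont: "continuous_on {0..1} \<Phi>"
    unfolding \<Phi>_def by (rule indefinite_integral_continuous_1[OF g_int])
  have \<Phi>_deriv: "(\<Phi> has_real_derivative g s) (at s)" if s: "0 < s" "s < 1" for s
  proof -
    have "continuous (at s) g"
      unfolding g_def using s by (intro continuous_intros) auto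
    then have "((\<lambda>u. integral {0..u} g) has_vector_derivative g s) (at s within {0..1} - {})"
      using s by (intro integral_has_vector_derivative_continuous_at[OF g_int])
        (auto intro: continuous_at_imp_continuous_at_within)
    moreover have "at s within {0..1} - {} = at s"
      using s by (intro at_within_interior) auto
    ultimately show ?thesis
      by (simp add: \<Phi>_def[abs_def] has_real_derivative_iff_has_vector_derivative)
  qed
  define t where "t x = real_zeta x ^ 3 / D" for x
  have t_compl: "1 - t x = real_zeta (- x) ^ 3 / D" if "\<bar>x\<bar> < 1 / 2" for x
    using real_zeta_fermat_cubic[OF that] D by (simp add: t_def field_simps D_def)
  have t_unit: "0 \<le> t x \<and> t x \<le> 1" if "x \<in> {- zero_abscissa..zero_abscissa}" for x
  proof -
    have nonneg: "0 \<le> real_zeta y" if "y \<in> {- zero_abscissa..zero_abscissa}" for y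
      using that real_zeta_pos[of y] real_zeta_zero_abscissa by (cases "y = zero_abscissa") auto
    have "0 \<le> real_zeta x" "0 \<le> real_zeta (- x)" using nonneg that by auto
    moreover have "\<bar>x\<bar> < 1 / 2" using that zero_abscissa_bounds by auto
    moreover have "0 \<le> t x" using \<open>0 \<le> real_zeta x\<close> D by (simp add: t_def)
    moreover have "0 \<le> 1 - t x"
      unfolding t_compl[OF \<open>\<bar>x\<bar> < 1 / 2\<close>] using \<open>0 \<le> real_zeta (- x)\<close> D by simp
    ultimately show ?thesis by simp
  qed
  have t_deriv: "(t has_real_derivative - (3 * (real_zeta x)\<^sup>2 * (real_zeta (- x))\<^sup>2 / D)) (at x)"
    if "\<bar>x\<bar> < 1 / 2" for x
    unfolding t_def using that D
    by (auto intro!: derivative_eq_intros real_zeta_ode)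
  \<comment> \<open>The linear term is chosen to cancel the constant slope of \<Phi> \<circ> t.\<close>
  define \<Psi> where "\<Psi> x = \<Phi> (t x) + 3 * D powr (1 / 3) * x" for x
  have "\<Psi> zero_abscissa = \<Psi> (- zero_abscissa)"
  proof (rule DERIV_isconst_end[where f = \<Psi> and a = "- zero_abscissa" and b = zero_abscissa])
    show "- zero_abscissa < zero_abscissa" using zero_abscissa_bounds by simp
    have "continuous_on {- zero_abscissa..zero_abscissa} t"
    proof (rule DERIV_atLeastAtMost_imp_continuous_on)
      fix x assume "- zero_abscissa \<le> x" "x \<le> zero_abscissa"
      then have "\<bar>x\<bar> < 1 / 2" using zero_abscissa_bounds by auto
      then show "\<exists>y. (t has_real_derivative y) (at x)" using t_deriv by blast
    qed
    then have "continuous_on {- zero_abscissa..zero_abscissa} (\<Phi> \<circ> t)"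
      by (rule continuous_on_compose) (use t_unit in \<open>auto intro: continuous_on_subset[OF \<Phi>_cont]\<close>)
    then show "continuous_on {- zero_abscissa..zero_abscissa} \<Psi>"
      unfolding \<Psi>_def o_def by (intro continuous_intros)
  next
    fix x assume x: "- zero_abscissa < x" "x < zero_abscissa"
    then have x2: "\<bar>x\<bar> < 1 / 2" using zero_abscissa_bounds by auto
    define a b where "a = real_zeta x" and "b = real_zeta (- x)"
    have ab: "a > 0" "b > 0" using real_zeta_pos x by (auto simp: a_def b_def)
    have ta: "t x = a ^ 3 / D" and tb: "1 - t x = b ^ 3 / D"
      using t_compl[OF x2] by (simp_all add: t_def a_def b_def)
    have "t x > 0" unfolding ta using ab D by simp
    moreover have "1 - t x > 0" unfolding tb using ab D by simp
    ultimately have d: "((\<lambda>x. \<Phi> (t x)) has_real_derivative g (t x) * - (3 * a\<^sup>2 * b\<^sup>2 / D)) (at x)"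
      using DERIV_chain2[OF \<Phi>_deriv t_deriv[OF x2]] by (simp add: a_def b_def)
    have pw: "(c ^ 3 / D) powr (- 2 / 3) = D powr (2 / 3) / c\<^sup>2" if "c > 0" for c
    proof -
      have "(c ^ 3 / D) powr (- 2 / 3) = (c powr 3) powr (- 2 / 3) / D powr (- 2 / 3)"
        using that D by (simp add: powr_divide)
      also have "(c powr 3) powr (- 2 / 3) = c powr (- 2)" by (simp add: powr_powr)
      also have "\<dots> = 1 / c\<^sup>2" using that by (simp add: powr_minus_divide)
      also have "D powr (- 2 / 3) = 1 / D powr (2 / 3)" by (simp add: powr_minus_divide)
      finally show ?thesis by simp
    qed
    have "D powr (2 / 3) * D powr (2 / 3) = D powr (1 + 1 / 3)" by (simp add: powr_add[symmetric])
    also have "\<dots> = D * D powr (1 / 3)" using D by (simp only: powr_add) simp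
    finally have DD: "D powr (2 / 3) * D powr (2 / 3) = D * D powr (1 / 3)" .
    have ga: "t x powr (- 2 / 3) = D powr (2 / 3) / a\<^sup>2" unfolding ta by (rule pw[OF ab(1)])
    have gb: "(1 - t x) powr (- 2 / 3) = D powr (2 / 3) / b\<^sup>2" unfolding tb by (rule pw[OF ab(2)])
    have "g (t x) = D * D powr (1 / 3) / (a\<^sup>2 * b\<^sup>2)"
      unfolding g_def ga gb by (simp only: times_divide_times_eq DD)
    then have "g (t x) * - (3 * a\<^sup>2 * b\<^sup>2 / D) = - (3 * D powr (1 / 3))"
      using ab D by (simp add: field_simps)
    then show "(\<Psi> has_real_derivative 0) (at x)"
      unfolding \<Psi>_def using d by (auto intro!: derivative_eq_intros)
  qed
  moreover have "t zero_abscissa = 0" by (simp add: t_def real_zeta_zero_abscissa)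
  moreover have "t (- zero_abscissa) = 1"
    using t_compl[of "- zero_abscissa"] zero_abscissa_bounds D real_zeta_zero_abscissa
    by (simp add: t_def)
  moreover have "\<Phi> 0 = 0" by (simp add: \<Phi>_def)
  moreover have "\<Phi> 1 = Beta (1 / 3) (1 / 3)" using g by (simp add: \<Phi>_def integral_unique)
  ultimately have B: "Beta (1 / 3) (1 / 3) = 6 * zero_abscissa * D powr (1 / 3)"
    by (simp add: \<Psi>_def)
  have "D powr (1 / 3) = 2 powr (1 / 3) * (real_zeta 0 ^ 3) powr (1 / 3)"
    unfolding D_def using real_zeta_0_pos by (simp add: powr_mult)
  also have "(real_zeta 0 ^ 3) powr (1 / 3) = (real_zeta 0 powr 3) powr (1 / 3)" using real_zeta_0_pos by simp
  also have "\<dots> = real_zeta 0 powr (3 * (1 / 3))" by (rule powr_powr)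
  also have "\<dots> = real_zeta 0" using real_zeta_0_pos by simp
  finally show ?thesis unfolding B zero_abscissa_def by simp
qed

lemma Gamma_third_two_thirds: "Gamma (1 / 3) * Gamma (2 / 3 :: real) = 2 * pi / sqrt 3"
proof -
  have eq: "1 - complex_of_real (1 / 3) = of_real (2 / 3)"
    "complex_of_real pi * of_real (1 / 3) = of_real (pi / 3)" by simp_all
  have "complex_of_real (Gamma (1 / 3) * Gamma (2 / 3)) = of_real (pi / sin (pi / 3))"
    using Gamma_reflection_complex[of "of_real (1 / 3)"]
    unfolding eq Gamma_complex_of_real sin_of_real by (simp only: of_real_mult of_real_divide)
  then have "Gamma (1 / 3) * Gamma (2 / 3) = pi / sin (pi / 3)"
    by (simp only: of_real_eq_iff)
  then show ?thesis by (simp add: sin_60)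
qed

text \<open>
Gamma(1/3) Gamma(2/3) = 2 \<pi> / sqrt 3 removes Gamma(2/3) from
Beta(1/3, 1/3) = Gamma(1/3)^2 / Gamma(2/3).
\<close>
theorem real_zeta_0_eq: "real_zeta 0 = 2 powr (- 4 / 3) / pi * Gamma (1 / 3) ^ 3"
proof -
  define G where "G = Gamma (1 / 3 :: real)"
  have G: "G > 0" by (simp add: G_def Gamma_real_pos)
  have "G * Gamma (2 / 3 :: real) = 2 * pi / sqrt 3"
    unfolding G_def by (rule Gamma_third_two_thirds)
  then have "Gamma (2 / 3 :: real) = 2 * pi / (sqrt 3 * G)"
    using G by (simp add: field_simps)
  then have "Beta (1 / 3) (1 / 3 :: real) = G ^ 3 * sqrt 3 / (2 * pi)"
    unfolding Beta_def G_def[symmetric] by (simp add: eval_nat_numeral)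
  then have "sqrt 3 * (2 powr (1 / 3) * real_zeta 0) = sqrt 3 * (G ^ 3 / (2 * pi))"
    using Beta_third by (simp add: mult_ac)
  moreover have "sqrt 3 \<noteq> (0::real)" by simp
  ultimately have "2 powr (1 / 3) * real_zeta 0 = G ^ 3 / (2 * pi)" using mult_left_cancel by blast
  then have "real_zeta 0 = G ^ 3 / pi * (1 / (2 * 2 powr (1 / 3)))"
    by (simp add: field_simps)
  also have "2 * 2 powr (1 / 3) = 2 powr (1 + 1 / 3 :: real)" by (simp only: powr_add) simp
  also have "1 / \<dots> = 2 powr (- 4 / 3 :: real)" by (simp add: powr_minus_divide)
  finally show ?thesis by (simp add: G_def)
qed

section \<open>The lattice sum for pseudo-factorials\<close>

theorem theorem3:
  fixes \<zeta> :: complex and r \<rho> :: real and n :: nat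
  assumes zeta: "\<zeta> = exp (\<i> * complex_of_real pi / 6)"
    and r: "6 * r = 2 powr (- 4 / 3) * 3 powr (1 / 2) / pi * Gamma (1 / 3) ^ 3"
    and rho: "\<rho> = 2 * r * sqrt 3"
    and n: "n \<ge> 2"
  shows "(\<lambda>(l :: int, m :: int). \<zeta> powi (8 * l + 4 * m) /
            ((of_int l - 1 / 2) * \<zeta> + (of_int m - 1 / 2) * inverse \<zeta>) ^ (n + 1))
           summable_on UNIV \<and>
         of_int (pseudo_factorial n) =
           - (fact n / complex_of_real \<rho> ^ (n + 1)) *
           (\<Sum>\<^sub>\<infinity>(l :: int, m :: int)\<in>UNIV. \<zeta> powi (8 * l + 4 * m) /
              ((of_int l - 1 / 2) * \<zeta> + (of_int m - 1 / 2) * inverse \<zeta>) ^ (n + 1))"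
proof -
  have "\<i> * complex_of_real pi / 6 = \<i> * complex_of_real (pi / 6)" by simp
  then have "\<zeta> = cis (pi / 6)" unfolding zeta by (simp only: cis_conv_exp)
  then have \<zeta>: "\<zeta> = \<xi>" by (simp add: \<xi>_def cis.code cos_30 sin_30)
  have "\<xi> powi (8 * l + 4 * m) = chi (l, m)" for l m
  proof -
    have "\<xi> powi (8 * l + 4 * m) = \<xi> powi (4 * (2 * l + m))" by (simp add: algebra_simps)
    also have "\<dots> = (\<xi> powi 4) powi (2 * l + m)" by (rule power_int_mult)
    finally show ?thesis by (simp add: xi_power4 chi_def)
  qed
  then have summand: "(\<lambda>(l :: int, m :: int). \<zeta> powi (8 * l + 4 * m) /
      ((of_int l - 1 / 2) * \<zeta> + (of_int m - 1 / 2) * inverse \<zeta>) ^ (n + 1))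
      = (\<lambda>i. chi i / pole i ^ (n + 1))"
    by (auto simp: fun_eq_iff \<zeta> pole_eq cnj_xi(1))
  have "\<rho> = 6 * r * (sqrt 3 / 3)" by (simp add: rho)
  also have "\<dots> = 2 powr (- 4 / 3) / pi * Gamma (1 / 3) ^ 3 * (3 powr (1 / 2) * (sqrt 3 / 3))"
    unfolding r by (simp only: times_divide_eq_left times_divide_eq_right mult_ac)
  also have "3 powr (1 / 2) * (sqrt 3 / 3) = (1 :: real)" by (simp add: powr_half_sqrt)
  finally have \<rho>: "\<rho> = real_zeta 0" by (simp only: real_zeta_0_eq mult_1_right)
  then have F0: "twisted_zeta 0 = of_real \<rho>" using twisted_zeta_of_real[of 0] by simp
  have "\<rho> \<noteq> 0" using real_zeta_0_pos \<rho> by simp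
  moreover have "of_real \<rho> ^ (n + 1) * of_int (pseudo_factorial n)
      = - fact n * (\<Sum>\<^sub>\<infinity>i. chi i / pole i ^ (n + 1))"
    using higher_deriv_twisted_zeta[OF n] higher_deriv_twisted_zeta_pseudo_factorial[of n] F0 by simp
  ultimately have "of_int (pseudo_factorial n)
      = - (fact n / complex_of_real \<rho> ^ (n + 1)) * (\<Sum>\<^sub>\<infinity>i. chi i / pole i ^ (n + 1))"
    by (simp add: field_simps)
  then show ?thesis
    unfolding summand using summable_character_sum[OF n] by blast
qed

end
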